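(* Let $\Phi$ be a $d\times K$ dictionary with unit-norm atoms $\varphi_1,\dots,\varphi_K$ and Babel function $\mu_1$. Assume a signal $y=\Phi_\Lambda x$ with $|\Lambda|=S$ satisfies the sufficient recovery condition for thresholding, $$\frac{|x_{\min}|}{\|x\|_\infty}>\mu_1(S)+\mu_1(S-1),$$ where $|x_{\min}|=\min_{i\in\Lambda}|x_i|$. If $A$ is an $n\times d$ random matrix whose entries are either independent $\mathcal{N}(0,n^{-1})$ random variables or independent $\pm1/\sqrt n$ Bernoulli random variables, then, for $t>0$, with probability at least $1-e^{-t}$ thresholding can recover $x$ (and hence $y$) from $s=Ay=A\Phi x$ as long as $$n\ge C_3\,S\,(1+\mu_1(S-1))\,(\log(2K)+t)\left(\frac{|x_{\min}|}{\|x\|_\infty}-\mu_1(S)-\mu_1(S-1)\right)^{-2}.$$ Here $C_3$ is an absolute constant satisfying $C_3\le 4C_1+2C_2\le17.71$, with $C_1=\frac{4e}{\sqrt{6\pi}}\approx2.5044$ and $C_2=e\sqrt2\approx3.8442$. In the special case that the dictionary is an orthonormal basis, the signal always satisfies the recovery condition and the bound for the necessary number of samples reduces to $$n> C_3\,S\left(\frac{\|x\|_\infty}{|x_{\min}|}\right)^2(\log(2K)+t).$$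
   Context: A dictionary is a deterministic $d\times K$ matrix with columns (atoms) $\varphi_1,\dots,\varphi_K$; $\Phi_\Lambda$ is the submatrix of columns indexed by $\Lambda\subset\{1,\dots,K\}$. Here $\Lambda$ is the support of the coefficient vector $x$ (so $x_i\neq0$ for $i\in\Lambda$), and $\Phi x=\Phi_\Lambda x$. The Babel function is $\mu_1(k):=\max_{|\Lambda|=k,\,j\notin\Lambda}\sum_{i\in\Lambda}|\langle\varphi_i,\varphi_j\rangle|$. Thresholding, applied to $s=\Psi x$ with $\Psi=A\Phi$ having columns $\psi_j=A\varphi_j$ and with sparsity $S$, finds the set $\Lambda'$ of indices corresponding to the $S$ largest values of $|\langle s,\psi_j\rangle|$ and outputs the coefficient vector $\Psi_{\Lambda'}^\dagger s$ on $\Lambda'$, where $\dagger$ denotes the pseudo-inverse. The signal is fixed (independent of $A$). $\mathcal{N}(0,n^{-1})$ is the centered Gaussian distribution with variance $1/n$; a $\pm1/\sqrt n$ Bernoulli variable takes each sign with probability $1/2$. $\log$ is the natural logarithm. *)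

theory Defs
  imports "HOL-Probability.Probability"
begin

section \<open>Dictionaries\<close>

text \<open>
  A \<open>d \<times> K\<close> dictionary is a matrix \<open>\<Phi> :: real ^ 'k ^ 'd\<close>; its atoms are the columns
  \<open>column j \<Phi>\<close>.
\<close>

definition unit_norm_atoms :: "real ^ 'k ^ 'd \<Rightarrow> bool" where
  "unit_norm_atoms \<Phi> \<longleftrightarrow> (\<forall>j. norm (column j \<Phi>) = 1)"

definition is_orthonormal_basis :: "real ^ 'k ^ 'd \<Rightarrow> bool" where
  "is_orthonormal_basis \<Phi> \<longleftrightarrow>
     (\<forall>i j. column i \<Phi> \<bullet> column j \<Phi> = (if i = j then 1 else 0)) \<and> span (columns \<Phi>) = UNIV"

text \<open>
  The element 0 is inserted only to give \<open>babel \<Phi> k\<close> the value 0 when there is no admissible pair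
  \<open>(\<Lambda>, j)\<close>, i.e. for \<open>k \<ge> K\<close>; otherwise it is harmless, the sums being nonnegative.
\<close>

definition babel :: "real ^ 'k ^ 'd \<Rightarrow> nat \<Rightarrow> real" where
  "babel \<Phi> k = Max (insert 0
     {\<Sum>i\<in>\<Lambda>. \<bar>column i \<Phi> \<bullet> column j \<Phi>\<bar> | \<Lambda> j. card \<Lambda> = k \<and> j \<notin> \<Lambda>})"

text \<open>
  Since the index set of the columns is a type, the submatrix with columns in \<open>\<Lambda>\<close> is represented by
  setting the other columns to zero.  Products with it ignore the coefficients outside \<open>\<Lambda>\<close>, and its
  pseudo-inverse is the pseudo-inverse of the genuine submatrix, padded by zero rows outside \<open>\<Lambda>\<close>.
\<close>

definition restrict_columns :: "real ^ 'k ^ 'm \<Rightarrow> 'k set \<Rightarrow> real ^ 'k ^ 'm" where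
  "restrict_columns B \<Lambda> = (\<chi> i j. if j \<in> \<Lambda> then B $ i $ j else 0)"

section \<open>Thresholding\<close>

text \<open>The Moore--Penrose pseudo-inverse.\<close>

definition is_pseudo_inverse :: "real ^ 'k ^ 'm \<Rightarrow> real ^ 'm ^ 'k \<Rightarrow> bool" where
  "is_pseudo_inverse B C \<longleftrightarrow>
     B ** C ** B = B \<and> C ** B ** C = C \<and>
     transpose (B ** C) = B ** C \<and> transpose (C ** B) = C ** B"

definition pseudo_inverse :: "real ^ 'k ^ 'm \<Rightarrow> real ^ 'm ^ 'k" where
  "pseudo_inverse B = (THE C. is_pseudo_inverse B C)"

definition largest_correlations :: "real ^ 'k ^ 'n \<Rightarrow> nat \<Rightarrow> real ^ 'n \<Rightarrow> 'k set \<Rightarrow> bool" where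
  "largest_correlations \<Psi> S s \<Lambda> \<longleftrightarrow> card \<Lambda> = S \<and>
     (\<forall>i\<in>\<Lambda>. \<forall>j. j \<notin> \<Lambda> \<longrightarrow> \<bar>s \<bullet> column j \<Psi>\<bar> \<le> \<bar>s \<bullet> column i \<Psi>\<bar>)"

text \<open>
  The index set of the \<open>S\<close> largest correlations is not unique in case of ties, so we collect the
  outputs for all possible choices.  Recovery demands that every choice leads to the coefficient
  vector \<open>x\<close> and to the signal \<open>y\<close>.
\<close>

definition thresholding :: "real ^ 'k ^ 'n \<Rightarrow> nat \<Rightarrow> real ^ 'n \<Rightarrow> (real ^ 'k) set" where
  "thresholding \<Psi> S s =
     {pseudo_inverse (restrict_columns \<Psi> \<Lambda>) *v s | \<Lambda>. largest_correlations \<Psi> S s \<Lambda>}"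

definition thresholding_recovers ::
    "real ^ 'k ^ 'd \<Rightarrow> nat \<Rightarrow> real ^ 'k \<Rightarrow> real ^ 'd \<Rightarrow> real ^ 'd ^ 'n \<Rightarrow> bool" where
  "thresholding_recovers \<Phi> S x y A \<longleftrightarrow>
     thresholding (A ** \<Phi>) S (A *v y) = {x} \<and>
     (\<lambda>z. \<Phi> *v z) ` thresholding (A ** \<Phi>) S (A *v y) = {y}"

definition min_abs_coeff :: "real ^ 'k \<Rightarrow> 'k set \<Rightarrow> real" where
  "min_abs_coeff x \<Lambda> = Min ((\<lambda>i. \<bar>x $ i\<bar>) ` \<Lambda>)"

section \<open>Random matrices\<close>

definition independent_entries :: "'w measure \<Rightarrow> ('w \<Rightarrow> real ^ 'd ^ 'n) \<Rightarrow> bool" where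
  "independent_entries M A \<longleftrightarrow>
     prob_space.indep_vars M (\<lambda>_. borel) (\<lambda>(i, j) \<omega>. A \<omega> $ i $ j) UNIV"

definition gaussian_matrix :: "'w measure \<Rightarrow> ('w \<Rightarrow> real ^ 'd ^ 'n) \<Rightarrow> bool" where
  "gaussian_matrix M A \<longleftrightarrow> independent_entries M A \<and>
     (\<forall>i j. distributed M lborel (\<lambda>\<omega>. A \<omega> $ i $ j) (normal_density 0 (1 / sqrt (real CARD('n)))))"

definition bernoulli_matrix :: "'w measure \<Rightarrow> ('w \<Rightarrow> real ^ 'd ^ 'n) \<Rightarrow> bool" where
  "bernoulli_matrix M A \<longleftrightarrow> independent_entries M A \<and>
     (\<forall>i j. measure M {\<omega> \<in> space M. A \<omega> $ i $ j = 1 / sqrt (real CARD('n))} = 1 / 2 \<and>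
            measure M {\<omega> \<in> space M. A \<omega> $ i $ j = - 1 / sqrt (real CARD('n))} = 1 / 2)"

section \<open>Constants\<close>

definition C1 :: real where
  "C1 = 4 * exp 1 / sqrt (6 * pi)"

definition C2 :: real where
  "C2 = exp 1 * sqrt 2"

text \<open>
  An absolute constant \<open>C3\<close> is only required to be at most \<open>4 * C1 + 2 * C2\<close>.  The required
  number of samples is increasing in \<open>C3\<close>, so the largest admissible value works as soon as some
  admissible value does; being a closed term, it depends on no dimension or probability space.
\<close>

definition C3 :: real where
  "C3 = 4 * C1 + 2 * C2"

end

theory Submission
  imports Defs
begin

text \<open>
  Let \<open>m = \<parallel>x\<parallel>\<^sub>\<infinity>\<close>, let \<open>p\<close> be the smallest modulus of a coefficient of \<open>x\<close> on \<open>\<Lambda>\<close>, and let \<open>L = log (2K) + t\<close>.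
  The correlations of the signal itself are separated: \<open>\<bar>\<langle>y, \<phi>\<^sub>i\<rangle>\<bar>\<close> is at least \<open>p - m \<mu>\<^sub>1(S - 1)\<close> for
  \<open>i \<in> \<Lambda>\<close> and at most \<open>m \<mu>\<^sub>1(S)\<close> for \<open>i \<notin> \<Lambda>\<close>, and the recovery condition says that the first number is
  the larger one.  After division by \<open>\<parallel>y\<parallel>\<close>, where \<open>\<parallel>y\<parallel>\<^sup>2 \<le> S (1 + \<mu>\<^sub>1(S - 1)) m\<^sup>2\<close>, the two numbers are
  \<open>b + 2\<tau>\<close> and \<open>b\<close>, and the bound on \<open>n\<close> implies \<open>n \<tau>\<^sup>2 \<ge> C3 L / 4\<close>.  Thresholding succeeds if some
  \<open>\<theta>\<close> separates the correlations of the compressed signal in the same way and if, moreover,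
  \<open>A \<Phi>\<close> is injective on vectors supported in \<open>\<Lambda>\<close>; injectivity is what makes the pseudo-inverse
  return \<open>x\<close> once the support has been found.

  For unit vectors \<open>u, v\<close> the number \<open>n \<langle>A u, A v\<rangle>\<close> is a sum of independent products
  \<open>\<langle>g, u\<rangle> \<langle>g, v\<rangle>\<close>, one for each row.  With \<open>\<rho> = \<langle>u, v\<rangle>\<close> and suitable unit vectors \<open>e, f\<close> such a product
  is the combination \<open>(1 + \<rho>)/2 \<langle>g, e\<rangle>\<^sup>2 - (1 - \<rho>)/2 \<langle>g, f\<rangle>\<^sup>2\<close>, whose weights add up to 1 in absolute
  value.  Hoelder's inequality therefore reduces its exponential moments to those of a single square,
  and these are bounded coordinate by coordinate, in one induction that serves Gaussian and sign
  entries alike (\<open>subgaussian_square_add\<close>).  The result (\<open>mgf_product_of_forms\<close>) is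

    \<open>log E exp(l \<langle>g, u\<rangle> \<langle>g, v\<rangle>) \<le> l \<rho> + l\<^sup>2 + (1 + \<rho>)/2 * O(l\<^sup>3)\<close>.

  Without the cubic term, Chernoff's bound would make a deviation by \<open>\<tau>\<close> have probability at most
  \<open>exp(- n \<tau>\<^sup>2 / 4)\<close>.  As \<open>C3 / 4 > 4.425\<close>, an error of about a tenth of the exponent is affordable, and
  the sign of \<open>\<rho>\<close> keeps the cubic term within it: on \<open>\<Lambda>\<close> only the lower tail matters, where the factor
  is \<open>(1 - \<bar>\<rho>\<bar>)/2\<close>, which vanishes in the critical case \<open>\<bar>\<rho>\<bar> = 1\<close>; off \<open>\<Lambda>\<close> both tails matter, but there
  \<open>\<bar>\<rho>\<bar> \<le> b \<le> 1 - 2\<tau>\<close>.  A suitable threshold \<open>\<theta>\<close> near the midpoint of \<open>b\<close> and \<open>b + 2\<tau>\<close> makes all these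
  probabilities at most \<open>exp(- L)\<close> (\<open>ex_separating_threshold\<close>).

  Injectivity can fail with positive probability for sign entries.  The rows of \<open>A\<close> are exposed one
  after the other: a nonzero subspace determined by the past is annihilated by the next row with
  probability at most \<open>exp(- 1/4)\<close>, and otherwise the part of the subspace that is annihilated by
  all rows so far drops in dimension (\<open>prob_rows_annihilate_le\<close>).  Since \<open>n\<close> is at least \<open>17.7 S L\<close>,
  this failure too has probability at most \<open>exp(- L)\<close>.  The one-sided tails on \<open>\<Lambda>\<close> leave room
  for it in the union bound: \<open>S + 2 (K - S) + 1 \<le> 2 K\<close>, and \<open>2 K exp(- L) = exp(- t)\<close>.
\<close>


section \<open>Squares of shifted sums of independent variables\<close>

lemma (in prob_space) nn_integral_indep_var:
  assumes ind: "indep_var N1 X N2 Y"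
    and f: "(\<lambda>(x, y). f x y) \<in> borel_measurable (N1 \<Otimes>\<^sub>M N2)"
  shows "(\<integral>\<^sup>+\<omega>. f (X \<omega>) (Y \<omega>) \<partial>M) = (\<integral>\<^sup>+\<omega>. \<integral>\<^sup>+\<omega>'. f (X \<omega>) (Y \<omega>') \<partial>M \<partial>M)"
proof -
  have X [measurable]: "X \<in> M \<rightarrow>\<^sub>M N1" and Y [measurable]: "Y \<in> M \<rightarrow>\<^sub>M N2"
    and eq: "distr M N1 X \<Otimes>\<^sub>M distr M N2 Y = distr M (N1 \<Otimes>\<^sub>M N2) (\<lambda>\<omega>. (X \<omega>, Y \<omega>))"
    using ind by (auto simp: indep_var_distribution_eq)
  note f [measurable]
  interpret Y: prob_space "distr M N2 Y"
    by (rule prob_space_distr) measurable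
  have "(\<integral>\<^sup>+\<omega>. f (X \<omega>) (Y \<omega>) \<partial>M)
      = (\<integral>\<^sup>+z. (case z of (x, y) \<Rightarrow> f x y) \<partial>distr M (N1 \<Otimes>\<^sub>M N2) (\<lambda>\<omega>. (X \<omega>, Y \<omega>)))"
    by (subst nn_integral_distr) auto
  also have "\<dots> = (\<integral>\<^sup>+x. \<integral>\<^sup>+y. f x y \<partial>distr M N2 Y \<partial>distr M N1 X)"
    unfolding eq [symmetric] by (subst Y.nn_integral_fst [symmetric]) (auto cong: measurable_cong_sets)
  also have "\<dots> = (\<integral>\<^sup>+\<omega>. \<integral>\<^sup>+y. f (X \<omega>) y \<partial>distr M N2 Y \<partial>M)"
    by (subst nn_integral_distr) auto
  also have "\<dots> = (\<integral>\<^sup>+\<omega>. \<integral>\<^sup>+\<omega>'. f (X \<omega>) (Y \<omega>') \<partial>M \<partial>M)"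
    by (intro nn_integral_cong nn_integral_distr) auto
  finally show ?thesis .
qed

text \<open>
  A comparison of the exponential moments of the squares \<open>(s + X)\<^sup>2\<close> with those of a centred Gaussian
  variable of variance \<open>W\<close>.  The first bound is the exact Gaussian formula.  The second one replaces
  the Gaussian exponent \<open>- \<eta> s\<^sup>2 / (2 (1 + \<eta> W)) - log (1 + \<eta> W) / 2\<close> by its second-order expansion in
  \<open>\<eta>\<close>, a weaker bound that sign variables satisfy as well.  The shift \<open>s\<close> is what makes both bounds
  pass to independent sums.
\<close>

definition subgaussian_square :: "'w measure \<Rightarrow> ('w \<Rightarrow> real) \<Rightarrow> real \<Rightarrow> bool" where
  "subgaussian_square M X W \<longleftrightarrow>
     (\<forall>\<eta> s. 0 \<le> \<eta> \<longrightarrow> \<eta> * W < 1 \<longrightarrow>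
        (\<integral>\<^sup>+\<omega>. ennreal (exp (\<eta> / 2 * (s + X \<omega>)\<^sup>2)) \<partial>M)
          \<le> ennreal (exp (\<eta> * s\<^sup>2 / (2 * (1 - \<eta> * W)) - ln (1 - \<eta> * W) / 2))) \<and>
     (\<forall>\<eta> s. 0 \<le> \<eta> \<longrightarrow> \<eta> * W \<le> 1 \<longrightarrow>
        (\<integral>\<^sup>+\<omega>. ennreal (exp (- \<eta> / 2 * (s + X \<omega>)\<^sup>2)) \<partial>M)
          \<le> ennreal (exp (- (\<eta> - \<eta>\<^sup>2 * W) * s\<^sup>2 / 2 - \<eta> * W / 2 + (\<eta> * W)\<^sup>2 / 4)))"

lemma subgaussian_squareD_pos:
  assumes "subgaussian_square M X W" "0 \<le> \<eta>" "\<eta> * W < 1"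
  shows "(\<integral>\<^sup>+\<omega>. ennreal (exp (\<eta> / 2 * (s + X \<omega>)\<^sup>2)) \<partial>M)
          \<le> ennreal (exp (\<eta> * s\<^sup>2 / (2 * (1 - \<eta> * W)) - ln (1 - \<eta> * W) / 2))"
  using assms unfolding subgaussian_square_def by blast

lemma subgaussian_squareD_neg:
  assumes "subgaussian_square M X W" "0 \<le> \<eta>" "\<eta> * W \<le> 1"
  shows "(\<integral>\<^sup>+\<omega>. ennreal (exp (- \<eta> / 2 * (s + X \<omega>)\<^sup>2)) \<partial>M)
          \<le> ennreal (exp (- (\<eta> - \<eta>\<^sup>2 * W) * s\<^sup>2 / 2 - \<eta> * W / 2 + (\<eta> * W)\<^sup>2 / 4))"
  using assms unfolding subgaussian_square_def by blast

text \<open>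
  Integrating out \<open>Y\<close> first leaves an exponential of the same kind in \<open>s + X\<close>, with \<open>\<eta>\<close> replaced by some
  \<open>\<zeta>\<close>, to which the bound for \<open>X\<close> applies.  For positive exponents \<open>\<zeta> = \<eta> / (1 - \<eta> W)\<close> and the Gaussian
  formulas compose exactly.  For negative ones \<open>\<zeta> = \<eta> - \<eta>\<^sup>2 W\<close> lies between 0 and \<open>\<eta>\<close>, and the cross
  term \<open>\<eta>\<^sup>2 V W / 2\<close> lost in \<open>\<zeta> V / 2\<close> is the mixed term of \<open>(\<eta> (V + W))\<^sup>2 / 4\<close>.
\<close>

lemma (in prob_space) subgaussian_square_add:
  assumes ind: "indep_var borel X borel Y"
    and X: "subgaussian_square M X V" and Y: "subgaussian_square M Y W"
    and V: "0 \<le> V" and W: "0 \<le> W"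
  shows "subgaussian_square M (\<lambda>\<omega>. X \<omega> + Y \<omega>) (V + W)"
proof -
  have [measurable]: "X \<in> borel_measurable M" "Y \<in> borel_measurable M"
    using ind by (auto simp: indep_var_distribution_eq)
  have cond: "(\<integral>\<^sup>+\<omega>. ennreal (exp (c * (s + (X \<omega> + Y \<omega>))\<^sup>2)) \<partial>M)
      = (\<integral>\<^sup>+\<omega>. \<integral>\<^sup>+\<omega>'. ennreal (exp (c * ((s + X \<omega>) + Y \<omega>')\<^sup>2)) \<partial>M \<partial>M)" for c s :: real
    using nn_integral_indep_var [OF ind, of "\<lambda>x y. ennreal (exp (c * (s + (x + y))\<^sup>2))"]
    by (simp add: add.assoc)
  show ?thesis
    unfolding subgaussian_square_def
  proof (intro conjI allI impI)
    fix \<eta> s :: real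
    assume \<eta>: "0 \<le> \<eta>" "\<eta> * (V + W) < 1"
    have \<eta>V: "0 \<le> \<eta> * V" and \<eta>W: "0 \<le> \<eta> * W" "\<eta> * W < 1"
      using \<eta> V W by (auto simp: algebra_simps) (smt (verit) mult_nonneg_nonneg)
    define \<zeta> where "\<zeta> = \<eta> / (1 - \<eta> * W)"
    have \<zeta>: "0 \<le> \<zeta>" "\<zeta> * V < 1"
      using \<eta> \<eta>V \<eta>W by (auto simp: \<zeta>_def field_simps)
    have split: "(1 - \<eta> * W) * (1 - \<zeta> * V) = 1 - \<eta> * (V + W)"
      using \<eta>W by (simp add: \<zeta>_def field_simps)
    have "(\<integral>\<^sup>+\<omega>. ennreal (exp (\<eta> / 2 * (s + (X \<omega> + Y \<omega>))\<^sup>2)) \<partial>M)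
        \<le> (\<integral>\<^sup>+\<omega>. ennreal (exp (\<eta> * (s + X \<omega>)\<^sup>2 / (2 * (1 - \<eta> * W)) - ln (1 - \<eta> * W) / 2)) \<partial>M)"
      unfolding cond using \<eta>(1) \<eta>W by (intro nn_integral_mono subgaussian_squareD_pos [OF Y]) auto
    also have "\<dots> = (\<integral>\<^sup>+\<omega>. ennreal (exp (- ln (1 - \<eta> * W) / 2))
                            * ennreal (exp (\<zeta> / 2 * (s + X \<omega>)\<^sup>2)) \<partial>M)"
      by (intro nn_integral_cong)
        (simp add: ennreal_mult [symmetric] exp_add [symmetric] \<zeta>_def)
    also have "\<dots> = ennreal (exp (- ln (1 - \<eta> * W) / 2))
                    * (\<integral>\<^sup>+\<omega>. ennreal (exp (\<zeta> / 2 * (s + X \<omega>)\<^sup>2)) \<partial>M)"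
      by (rule nn_integral_cmult) measurable
    also have "\<dots> \<le> ennreal (exp (- ln (1 - \<eta> * W) / 2))
                    * ennreal (exp (\<zeta> * s\<^sup>2 / (2 * (1 - \<zeta> * V)) - ln (1 - \<zeta> * V) / 2))"
      by (intro mult_left_mono subgaussian_squareD_pos [OF X]) (use \<zeta> in auto)
    also have "\<dots> = ennreal (exp (\<zeta> * s\<^sup>2 / (2 * (1 - \<zeta> * V))
                                 - (ln (1 - \<eta> * W) + ln (1 - \<zeta> * V)) / 2))"
      by (simp add: ennreal_mult [symmetric] exp_add [symmetric] algebra_simps add_divide_distrib)
    also have "ln (1 - \<eta> * W) + ln (1 - \<zeta> * V) = ln (1 - \<eta> * (V + W))"
      unfolding split [symmetric] using \<eta>W \<zeta> by (simp add: ln_mult)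
    also have "\<zeta> * s\<^sup>2 / (2 * (1 - \<zeta> * V)) = \<eta> * s\<^sup>2 / (2 * (1 - \<eta> * (V + W)))"
    proof -
      have "\<zeta> * s\<^sup>2 / (2 * (1 - \<zeta> * V)) = \<eta> * s\<^sup>2 / (2 * ((1 - \<eta> * W) * (1 - \<zeta> * V)))"
        by (simp add: \<zeta>_def)
      then show ?thesis by (simp add: split)
    qed
    finally show "(\<integral>\<^sup>+\<omega>. ennreal (exp (\<eta> / 2 * (s + (X \<omega> + Y \<omega>))\<^sup>2)) \<partial>M)
        \<le> ennreal (exp (\<eta> * s\<^sup>2 / (2 * (1 - \<eta> * (V + W))) - ln (1 - \<eta> * (V + W)) / 2))" .
  next
    fix \<eta> s :: real
    assume \<eta>: "0 \<le> \<eta>" "\<eta> * (V + W) \<le> 1"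
    have \<eta>V: "0 \<le> \<eta> * V" and \<eta>W: "0 \<le> \<eta> * W" "\<eta> * W \<le> 1"
      using \<eta> V W by (auto simp: algebra_simps) (smt (verit) mult_nonneg_nonneg)
    define \<zeta> where "\<zeta> = \<eta> - \<eta>\<^sup>2 * W"
    have \<zeta>_eq: "\<zeta> = \<eta> * (1 - \<eta> * W)" by (simp add: \<zeta>_def power2_eq_square algebra_simps)
    have \<zeta>: "0 \<le> \<zeta>" "\<zeta> \<le> \<eta>"
      unfolding \<zeta>_eq using \<eta>(1) \<eta>W by (auto intro: mult_left_le)
    have \<zeta>2: "\<zeta>\<^sup>2 \<le> \<eta>\<^sup>2" using \<zeta> by (intro power_mono) auto
    have \<zeta>V: "\<zeta> * V \<le> 1"
      using mult_right_mono [OF \<zeta>(2) V] \<eta> \<eta>W by (simp add: algebra_simps)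
    have "(\<integral>\<^sup>+\<omega>. ennreal (exp (- \<eta> / 2 * (s + (X \<omega> + Y \<omega>))\<^sup>2)) \<partial>M)
        \<le> (\<integral>\<^sup>+\<omega>. ennreal (exp (- (\<eta> - \<eta>\<^sup>2 * W) * (s + X \<omega>)\<^sup>2 / 2 - \<eta> * W / 2 + (\<eta> * W)\<^sup>2 / 4)) \<partial>M)"
      unfolding cond using \<eta>(1) \<eta>W by (intro nn_integral_mono subgaussian_squareD_neg [OF Y]) auto
    also have "\<dots> = (\<integral>\<^sup>+\<omega>. ennreal (exp (- \<eta> * W / 2 + (\<eta> * W)\<^sup>2 / 4))
                            * ennreal (exp (- \<zeta> / 2 * (s + X \<omega>)\<^sup>2)) \<partial>M)"
      by (intro nn_integral_cong)
        (simp add: ennreal_mult [symmetric] exp_add [symmetric] \<zeta>_def algebra_simps)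
    also have "\<dots> = ennreal (exp (- \<eta> * W / 2 + (\<eta> * W)\<^sup>2 / 4))
                    * (\<integral>\<^sup>+\<omega>. ennreal (exp (- \<zeta> / 2 * (s + X \<omega>)\<^sup>2)) \<partial>M)"
      by (rule nn_integral_cmult) measurable
    also have "\<dots> \<le> ennreal (exp (- \<eta> * W / 2 + (\<eta> * W)\<^sup>2 / 4))
        * ennreal (exp (- (\<zeta> - \<zeta>\<^sup>2 * V) * s\<^sup>2 / 2 - \<zeta> * V / 2 + (\<zeta> * V)\<^sup>2 / 4))"
      by (intro mult_left_mono subgaussian_squareD_neg [OF X]) (use \<zeta> \<zeta>V in auto)
    also have "\<dots> = ennreal (exp ((- \<eta> * W / 2 + (\<eta> * W)\<^sup>2 / 4)
        + (- (\<zeta> - \<zeta>\<^sup>2 * V) * s\<^sup>2 / 2 - \<zeta> * V / 2 + (\<zeta> * V)\<^sup>2 / 4)))"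
      by (simp add: ennreal_mult [symmetric] exp_add [symmetric])
    also have "\<dots> \<le> ennreal (exp (- (\<eta> - \<eta>\<^sup>2 * (V + W)) * s\<^sup>2 / 2 - \<eta> * (V + W) / 2
                                  + (\<eta> * (V + W))\<^sup>2 / 4))"
    proof -
      have "\<zeta>\<^sup>2 * V \<le> \<eta>\<^sup>2 * V" by (rule mult_right_mono [OF \<zeta>2 V])
      then have "(\<zeta> - \<zeta>\<^sup>2 * V) * s\<^sup>2 \<ge> (\<eta> - \<eta>\<^sup>2 * (V + W)) * s\<^sup>2"
        by (intro mult_right_mono) (auto simp: \<zeta>_def algebra_simps)
      moreover have "(\<zeta> * V)\<^sup>2 \<le> (\<eta> * V)\<^sup>2"
        using \<zeta> V by (intro power_mono mult_right_mono) auto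
      moreover have "(\<eta> * (V + W))\<^sup>2 = (\<eta> * V)\<^sup>2 + 2 * (\<eta>\<^sup>2 * W * V) + (\<eta> * W)\<^sup>2"
        by (simp add: power2_eq_square algebra_simps)
      moreover have "\<zeta> * V = \<eta> * V - \<eta>\<^sup>2 * W * V" by (simp add: \<zeta>_def algebra_simps)
      ultimately show ?thesis
        by (intro ennreal_leI) (simp add: field_simps)
    qed
    finally show "(\<integral>\<^sup>+\<omega>. ennreal (exp (- \<eta> / 2 * (s + (X \<omega> + Y \<omega>))\<^sup>2)) \<partial>M)
        \<le> ennreal (exp (- (\<eta> - \<eta>\<^sup>2 * (V + W)) * s\<^sup>2 / 2 - \<eta> * (V + W) / 2
                        + (\<eta> * (V + W))\<^sup>2 / 4))" .
  qed
qed

lemma (in prob_space) subgaussian_square_sum: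
  fixes X :: "'i \<Rightarrow> 'a \<Rightarrow> real"
  assumes "finite J" "indep_vars (\<lambda>_. borel) X J"
    and "\<And>j. j \<in> J \<Longrightarrow> subgaussian_square M (X j) (V j)" "\<And>j. j \<in> J \<Longrightarrow> 0 \<le> V j"
  shows "subgaussian_square M (\<lambda>\<omega>. \<Sum>j\<in>J. X j \<omega>) (\<Sum>j\<in>J. V j)"
  using assms
proof (induction J rule: finite_induct)
  case empty
  show ?case
    by (auto simp: subgaussian_square_def emeasure_space_1)
next
  case (insert j J)
  have "subgaussian_square M (\<lambda>\<omega>. X j \<omega> + (\<Sum>j\<in>J. X j \<omega>)) (V j + (\<Sum>j\<in>J. V j))"
  proof (rule subgaussian_square_add)
    show "indep_var borel (X j) borel (\<lambda>\<omega>. \<Sum>j\<in>J. X j \<omega>)"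
      using insert by (intro indep_vars_sum) auto
    show "subgaussian_square M (\<lambda>\<omega>. \<Sum>j\<in>J. X j \<omega>) (\<Sum>j\<in>J. V j)"
      using insert by (intro insert.IH) (auto intro: indep_vars_subset)
  qed (use insert in \<open>auto intro: sum_nonneg\<close>)
  then show ?case using insert by simp
qed

section \<open>Gaussian and sign variables\<close>

text \<open>
  Completing the square turns the integrand into a multiple of the normal density with mean \<open>m\<close> and
  variance \<open>1 / D\<close>.
\<close>

lemma normal_density_exp_square:
  fixes H s w :: real
  assumes "H * w\<^sup>2 < 1"
  shows "(\<integral>\<^sup>+x. ennreal (normal_density 0 1 x) * ennreal (exp (H / 2 * (s + w * x)\<^sup>2)) \<partial>lborel)
    = ennreal (exp (H * s\<^sup>2 / (2 * (1 - H * w\<^sup>2)) - ln (1 - H * w\<^sup>2) / 2))"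
proof -
  define D where "D = 1 - H * w\<^sup>2"
  have D: "0 < D" using assms by (simp add: D_def)
  define \<sigma> where "\<sigma> = 1 / sqrt D"
  define m where "m = H * s * w / D"
  have \<sigma>: "0 < \<sigma>" "\<sigma>\<^sup>2 = 1 / D" using D by (auto simp: \<sigma>_def power_divide)
  have ln\<sigma>: "exp (- ln D / 2) = \<sigma>"
    using D by (simp add: \<sigma>_def ln_sqrt [symmetric] exp_minus inverse_eq_divide)
  have eq: "normal_density 0 1 x * exp (H / 2 * (s + w * x)\<^sup>2)
      = exp (H * s\<^sup>2 / (2 * D) - ln D / 2) * normal_density m \<sigma> x" for x
  proof -
    have "normal_density m \<sigma> x = exp (- (x - m)\<^sup>2 * D / 2) / (sqrt (2 * pi) * \<sigma>)"
      using \<sigma> D by (simp add: normal_density_def real_sqrt_mult real_sqrt_divide \<sigma>_def)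
    moreover have "- x\<^sup>2 / 2 + H / 2 * (s + w * x)\<^sup>2 = H * s\<^sup>2 / (2 * D) + - (x - m)\<^sup>2 * D / 2"
    proof -
      have Dm: "D * m = H * s * w" and Hw: "H * w\<^sup>2 = 1 - D"
        using D by (auto simp: m_def D_def)
      have "(H * s\<^sup>2 + H * s * w * m) * D = H * s\<^sup>2 * D + H * s * w * (D * m)"
        by (simp add: algebra_simps)
      also have "\<dots> = H * s\<^sup>2 * (D + H * w\<^sup>2)"
        unfolding Dm by (simp add: power2_eq_square algebra_simps)
      also have "\<dots> = H * s\<^sup>2"
        unfolding Hw by simp
      finally have 1: "H * s\<^sup>2 / (2 * D) = (H * s\<^sup>2 + H * s * w * m) / 2"
        using D by (simp add: field_simps)
      have 2: "H / 2 * (s + w * x)\<^sup>2 = (H * s\<^sup>2 + 2 * (H * s * w) * x + (H * w\<^sup>2) * x\<^sup>2) / 2"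
        by (simp add: power2_eq_square algebra_simps)
      have 3: "- (x - m)\<^sup>2 * D / 2 = - (D * x\<^sup>2 - 2 * (D * m) * x + (D * m) * m) / 2"
        by (simp add: power2_eq_square algebra_simps)
      show ?thesis
        unfolding 1 2 3 Dm Hw by (simp add: algebra_simps add_divide_distrib diff_divide_distrib)
    qed
    moreover have "exp (H * s\<^sup>2 / (2 * D) - ln D / 2) = exp (H * s\<^sup>2 / (2 * D)) * \<sigma>"
      using exp_add [of "H * s\<^sup>2 / (2 * D)" "- ln D / 2"] ln\<sigma> by simp
    ultimately show ?thesis
      using \<sigma> by (simp add: normal_density_def exp_add [symmetric])
  qed
  have "(\<integral>\<^sup>+x. ennreal (normal_density 0 1 x) * ennreal (exp (H / 2 * (s + w * x)\<^sup>2)) \<partial>lborel)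
      = (\<integral>\<^sup>+x. ennreal (exp (H * s\<^sup>2 / (2 * D) - ln D / 2)) * ennreal (normal_density m \<sigma> x) \<partial>lborel)"
    by (intro nn_integral_cong) (metis ennreal_mult' eq exp_ge_zero normal_density_nonneg)
  also have "\<dots> = ennreal (exp (H * s\<^sup>2 / (2 * D) - ln D / 2)) * (\<integral>\<^sup>+x. ennreal (normal_density m \<sigma> x) \<partial>lborel)"
    by (rule nn_integral_cmult) measurable
  also have "(\<integral>\<^sup>+x. ennreal (normal_density m \<sigma> x) \<partial>lborel) = 1"
    using \<sigma> by (subst nn_integral_eq_integral) auto
  finally show ?thesis by (simp add: D_def)
qed

lemma ln_one_plus_ge: "c - c\<^sup>2 / 2 \<le> ln (1 + c)" if "0 \<le> c" for c :: real
proof -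
  have "ln (1 + 0) - (0 - 0\<^sup>2 / 2) \<le> ln (1 + c) - (c - c\<^sup>2 / 2)"
  proof (rule DERIV_nonneg_imp_nondecreasing [OF that])
    fix x :: real
    assume x: "0 \<le> x"
    then have "((\<lambda>x. ln (1 + x) - (x - x\<^sup>2 / 2)) has_real_derivative (1 / (1 + x) - (1 - x))) (at x)"
      by (auto intro!: derivative_eq_intros)
    moreover have "0 \<le> 1 / (1 + x) - (1 - x)"
      using x by (simp add: field_simps)
    ultimately show "\<exists>y. ((\<lambda>x. ln (1 + x) - (x - x\<^sup>2 / 2)) has_real_derivative y) (at x) \<and> 0 \<le> y"
      by blast
  qed
  then show ?thesis by simp
qed

lemma gaussian_subgaussian_square:
  assumes "distributed M lborel X (normal_density 0 1)"
  shows "subgaussian_square M (\<lambda>\<omega>. w * X \<omega>) (w\<^sup>2)"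
proof -
  have int: "(\<integral>\<^sup>+\<omega>. ennreal (exp (H / 2 * (s + w * X \<omega>)\<^sup>2)) \<partial>M)
      = ennreal (exp (H * s\<^sup>2 / (2 * (1 - H * w\<^sup>2)) - ln (1 - H * w\<^sup>2) / 2))"
    if "H * w\<^sup>2 < 1" for H s :: real
    using distributed_nn_integral [OF assms, of "\<lambda>x. ennreal (exp (H / 2 * (s + w * x)\<^sup>2))"]
      normal_density_exp_square [OF that, of s] by simp
  show ?thesis
    unfolding subgaussian_square_def
  proof (intro conjI allI impI)
    fix \<eta> s :: real
    assume \<eta>: "0 \<le> \<eta>" "\<eta> * w\<^sup>2 \<le> 1"
    define c where "c = \<eta> * w\<^sup>2"
    have c: "0 \<le> c" using \<eta> by (simp add: c_def)
    have "(\<integral>\<^sup>+\<omega>. ennreal (exp (- \<eta> / 2 * (s + w * X \<omega>)\<^sup>2)) \<partial>M)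
        = ennreal (exp (- \<eta> * s\<^sup>2 / (2 * (1 + c)) - ln (1 + c) / 2))"
      using int [of "- \<eta>" s] c by (simp add: c_def)
    also have "\<dots> \<le> ennreal (exp (- (\<eta> - \<eta>\<^sup>2 * w\<^sup>2) * s\<^sup>2 / 2 - \<eta> * w\<^sup>2 / 2 + (\<eta> * w\<^sup>2)\<^sup>2 / 4))"
    proof -
      have "c - c\<^sup>2 / 2 \<le> ln (1 + c)"
        by (rule ln_one_plus_ge [OF c])
      moreover define Z where "Z = \<eta> * s\<^sup>2 / (1 + c)"
      have "1 - c \<le> 1 / (1 + c)"
        using c by (simp add: field_simps)
      then have "(1 - c) * (\<eta> * s\<^sup>2) \<le> 1 / (1 + c) * (\<eta> * s\<^sup>2)"
        using \<eta> by (intro mult_right_mono) auto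
      then have "(1 - c) * (\<eta> * s\<^sup>2) \<le> Z"
        by (simp add: Z_def)
      moreover have "- (\<eta> - \<eta>\<^sup>2 * w\<^sup>2) * s\<^sup>2 / 2 = - ((1 - c) * (\<eta> * s\<^sup>2)) / 2"
        by (simp add: c_def power2_eq_square algebra_simps)
      moreover have "- \<eta> * s\<^sup>2 / (2 * (1 + c)) = - Z / 2"
        by (simp add: Z_def)
      ultimately show ?thesis
        unfolding c_def [symmetric] by (intro ennreal_leI) simp
    qed
    finally show "(\<integral>\<^sup>+\<omega>. ennreal (exp (- \<eta> / 2 * (s + w * X \<omega>)\<^sup>2)) \<partial>M)
        \<le> ennreal (exp (- (\<eta> - \<eta>\<^sup>2 * w\<^sup>2) * s\<^sup>2 / 2 - \<eta> * w\<^sup>2 / 2 + (\<eta> * w\<^sup>2)\<^sup>2 / 4))" .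
  qed (simp only: int order_refl)
qed

text \<open>
  The derivative of \<open>x\<^sup>2 / 2 - log (cosh x)\<close> is \<open>x - tanh x\<close>, which is nonnegative for \<open>x \<ge> 0\<close>.
\<close>

lemma cosh_le_exp_square: "cosh x \<le> exp (x\<^sup>2 / 2)" for x :: real
proof -
  have tanh: "tanh y \<le> y" if "0 \<le> y" for y :: real
  proof -
    have "0 - tanh 0 \<le> y - tanh y"
      using that by (rule DERIV_nonneg_imp_nondecreasing)
        (auto intro!: exI derivative_eq_intros simp: cosh_real_nonzero)
    then show ?thesis by simp
  qed
  have "0\<^sup>2 / 2 - ln (cosh 0) \<le> \<bar>x\<bar>\<^sup>2 / 2 - ln (cosh \<bar>x\<bar>)"
    by (rule DERIV_nonneg_imp_nondecreasing)
      (auto intro!: exI derivative_eq_intros tanh [unfolded tanh_def] simp: cosh_real_pos)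
  then have "ln (cosh x) \<le> x\<^sup>2 / 2"
    by simp
  then show ?thesis
    by (metis cosh_real_pos exp_le_cancel_iff exp_ln)
qed

text \<open>
  The square \<open>(s + w X)\<^sup>2 = s\<^sup>2 + w\<^sup>2 + 2 s w X\<close> is affine in the sign \<open>X\<close>, so its exponential moment
  is a hyperbolic cosine, which is dominated by the corresponding Gaussian exponential.
\<close>

lemma (in prob_space) two_point_subgaussian_square:
  fixes X :: "'a \<Rightarrow> real"
  assumes X: "X \<in> borel_measurable M"
    and p: "prob {\<omega> \<in> space M. X \<omega> = 1} = 1 / 2" "prob {\<omega> \<in> space M. X \<omega> = - 1} = 1 / 2"
  shows "subgaussian_square M (\<lambda>\<omega>. w * X \<omega>) (w\<^sup>2)"
proof -
  note X [measurable]
  define P N where "P = {\<omega> \<in> space M. X \<omega> = 1}" and "N = {\<omega> \<in> space M. X \<omega> = - 1}"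
  have PN [measurable]: "P \<in> events" "N \<in> events" unfolding P_def N_def by measurable
  have "prob (P \<union> N) = 1"
  proof -
    have "prob (P \<union> N) = prob P + prob N"
      by (rule finite_measure_Union [OF PN]) (auto simp: P_def N_def)
    then show ?thesis using p by (simp add: P_def N_def)
  qed
  then have AE: "AE \<omega> in M. \<omega> \<in> P \<union> N"
    using PN by (subst prob_eq_1 [symmetric]) auto
  have emeasure_PN: "emeasure M P = ennreal (1 / 2)" "emeasure M N = ennreal (1 / 2)"
    using p by (simp_all only: emeasure_eq_measure P_def N_def)
  have int: "(\<integral>\<^sup>+\<omega>. ennreal (exp (H / 2 * (s + w * X \<omega>)\<^sup>2)) \<partial>M)
      = ennreal (exp (H / 2 * s\<^sup>2 + H / 2 * w\<^sup>2) * cosh (H * s * w))" for H s :: real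
  proof -
    have "(\<integral>\<^sup>+\<omega>. ennreal (exp (H / 2 * (s + w * X \<omega>)\<^sup>2)) \<partial>M)
        = (\<integral>\<^sup>+\<omega>. ennreal (exp (H / 2 * (s + w)\<^sup>2)) * indicator P \<omega>
                 + ennreal (exp (H / 2 * (s - w)\<^sup>2)) * indicator N \<omega> \<partial>M)"
      by (intro nn_integral_cong_AE) (use AE in eventually_elim, auto simp: P_def N_def)
    also have "\<dots> = ennreal (exp (H / 2 * (s + w)\<^sup>2)) * ennreal (1 / 2)
                    + ennreal (exp (H / 2 * (s - w)\<^sup>2)) * ennreal (1 / 2)"
      by (subst nn_integral_add) (auto simp: nn_integral_cmult emeasure_PN)
    also have "\<dots> = ennreal ((exp (H / 2 * (s + w)\<^sup>2) + exp (H / 2 * (s - w)\<^sup>2)) / 2)"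
      unfolding ennreal_mult' [OF exp_ge_zero, symmetric]
      by (subst ennreal_plus [symmetric]) (auto simp: add_divide_distrib)
    also have "(exp (H / 2 * (s + w)\<^sup>2) + exp (H / 2 * (s - w)\<^sup>2)) / 2
        = exp (H / 2 * s\<^sup>2 + H / 2 * w\<^sup>2) * cosh (H * s * w)"
      by (simp add: cosh_field_def exp_add [symmetric] exp_minus [symmetric] distrib_left
          power2_eq_square algebra_simps add_divide_distrib flip: exp_add)
    finally show ?thesis .
  qed
  show ?thesis
    unfolding subgaussian_square_def
  proof (intro conjI allI impI)
    fix \<eta> s :: real
    assume \<eta>: "0 \<le> \<eta>" "\<eta> * w\<^sup>2 < 1"
    define c where "c = \<eta> * w\<^sup>2"
    have c: "0 \<le> c" "c < 1" using \<eta> by (simp_all add: c_def)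
    have "exp (\<eta> / 2 * s\<^sup>2 + \<eta> / 2 * w\<^sup>2) * cosh (\<eta> * s * w)
        \<le> exp (\<eta> / 2 * s\<^sup>2 + \<eta> / 2 * w\<^sup>2) * exp ((\<eta> * s * w)\<^sup>2 / 2)"
      by (intro mult_left_mono cosh_le_exp_square) auto
    also have "\<dots> = exp ((1 + c) * (\<eta> * s\<^sup>2) / 2 + c / 2)"
      by (simp add: exp_add [symmetric] c_def power2_eq_square algebra_simps add_divide_distrib)
    also have "\<dots> \<le> exp (1 / (1 - c) * (\<eta> * s\<^sup>2) / 2 - ln (1 - c) / 2)"
    proof -
      have "1 + c \<le> 1 / (1 - c)" using c by (simp add: field_simps)
      then have "(1 + c) * (\<eta> * s\<^sup>2) \<le> 1 / (1 - c) * (\<eta> * s\<^sup>2)"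
        using \<eta> by (intro mult_right_mono) auto
      moreover have "c \<le> - ln (1 - c)" using c ln_add_one_self_le_self2 [of "- c"] by simp
      ultimately have "(1 + c) * (\<eta> * s\<^sup>2) / 2 + c / 2
          \<le> 1 / (1 - c) * (\<eta> * s\<^sup>2) / 2 + - ln (1 - c) / 2"
        by (intro add_mono divide_right_mono) auto
      then show ?thesis by (simp only: exp_le_cancel_iff diff_conv_add_uminus minus_divide_left)
    qed
    finally show "(\<integral>\<^sup>+\<omega>. ennreal (exp (\<eta> / 2 * (s + w * X \<omega>)\<^sup>2)) \<partial>M)
        \<le> ennreal (exp (\<eta> * s\<^sup>2 / (2 * (1 - \<eta> * w\<^sup>2)) - ln (1 - \<eta> * w\<^sup>2) / 2))"
      unfolding int by (intro ennreal_leI) (simp add: c_def mult.commute)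
  next
    fix \<eta> s :: real
    have "exp (- \<eta> / 2 * s\<^sup>2 + - \<eta> / 2 * w\<^sup>2) * cosh (- \<eta> * s * w)
        \<le> exp (- \<eta> / 2 * s\<^sup>2 + - \<eta> / 2 * w\<^sup>2) * exp ((- \<eta> * s * w)\<^sup>2 / 2)"
      by (intro mult_left_mono cosh_le_exp_square) auto
    also have "\<dots> = exp (- (\<eta> - \<eta>\<^sup>2 * w\<^sup>2) * s\<^sup>2 / 2 - \<eta> * w\<^sup>2 / 2)"
      by (simp add: exp_add [symmetric] power2_eq_square algebra_simps add_divide_distrib diff_divide_distrib)
    also have "\<dots> \<le> exp (- (\<eta> - \<eta>\<^sup>2 * w\<^sup>2) * s\<^sup>2 / 2 - \<eta> * w\<^sup>2 / 2 + (\<eta> * w\<^sup>2)\<^sup>2 / 4)"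
      by simp
    finally show "(\<integral>\<^sup>+\<omega>. ennreal (exp (- \<eta> / 2 * (s + w * X \<omega>)\<^sup>2)) \<partial>M)
        \<le> ennreal (exp (- (\<eta> - \<eta>\<^sup>2 * w\<^sup>2) * s\<^sup>2 / 2 - \<eta> * w\<^sup>2 / 2 + (\<eta> * w\<^sup>2)\<^sup>2 / 4))"
      unfolding int by (intro ennreal_leI)
  qed
qed

section \<open>Products of two linear forms of a random row\<close>

text \<open>
  For a standard Gaussian \<open>g\<close>, \<open>log E exp (l (g\<^sup>2 - 1)) = l\<^sup>2 + log_mgf_excess l\<close>: what remains of the
  log moment generating function of a centred chi-square variable beyond its quadratic term.
\<close>

definition log_mgf_excess :: "real \<Rightarrow> real" where
  "log_mgf_excess l = - ln (1 - 2 * l) / 2 - l - l\<^sup>2"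

text \<open>
  Polarization, with \<open>u + v\<close> and \<open>u - v\<close> normalized to \<open>e\<close> and \<open>f\<close>.  If one of them vanishes, so does its
  weight, and any unit vector serves.
\<close>

lemma inner_mult_inner_diff_squares:
  fixes u v :: "'a :: real_inner"
  assumes "norm u = 1" "norm v = 1"
  obtains e f where "norm e = 1" "norm f = 1"
    "\<And>g. (g \<bullet> u) * (g \<bullet> v)
       = (1 + u \<bullet> v) / 2 * (g \<bullet> e)\<^sup>2 - (1 - u \<bullet> v) / 2 * (g \<bullet> f)\<^sup>2"
proof -
  have split: "\<exists>e. norm e = 1 \<and> z = norm z *\<^sub>R e" for z :: 'a
  proof (cases "z = 0")
    case False
    then show ?thesis by (intro exI [of _ "sgn z"]) (simp add: norm_sgn sgn_div_norm)
  qed (use assms in auto)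
  obtain e where e: "norm e = 1" "u + v = norm (u + v) *\<^sub>R e"
    using split by blast
  obtain f where f: "norm f = 1" "u - v = norm (u - v) *\<^sub>R f"
    using split by blast
  have [simp]: "u \<bullet> u = 1" "v \<bullet> v = 1"
    using assms by (simp_all add: dot_square_norm)
  have norms: "(norm (u + v))\<^sup>2 = 2 * (1 + u \<bullet> v)" "(norm (u - v))\<^sup>2 = 2 * (1 - u \<bullet> v)"
    unfolding power2_norm_eq_inner by (simp_all add: inner_simps inner_commute)
  show ?thesis
  proof (rule that [OF e(1) f(1)])
    fix g
    have "(g \<bullet> u) * (g \<bullet> v) = ((g \<bullet> (u + v))\<^sup>2 - (g \<bullet> (u - v))\<^sup>2) / 4"
      by (simp add: inner_simps power2_eq_square algebra_simps)
    also have "g \<bullet> (u + v) = norm (u + v) * (g \<bullet> e)"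
      by (subst e(2)) simp
    also have "g \<bullet> (u - v) = norm (u - v) * (g \<bullet> f)"
      by (subst f(2)) simp
    finally show "(g \<bullet> u) * (g \<bullet> v)
       = (1 + u \<bullet> v) / 2 * (g \<bullet> e)\<^sup>2 - (1 - u \<bullet> v) / 2 * (g \<bullet> f)\<^sup>2"
      by (simp add: power_mult_distrib norms field_simps)
  qed
qed

lemma exp_convex_combination_le:
  fixes a b A B p r :: real
  assumes "0 \<le> p" "0 \<le> r" "p + r = 1"
  shows "exp (p * a + r * b) \<le> exp (p * A + r * B) * (p * exp (a - A) + r * exp (b - B))"
proof -
  have "exp (p * (a - A) + r * (b - B)) \<le> p * exp (a - A) + r * exp (b - B)"
  proof -
    have p: "p = 1 - r" using assms by simp
    show ?thesis
      unfolding p using assms convex_onD [OF exp_convex, of r "a - A" "b - B"] by simp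
  qed
  moreover have "exp (p * a + r * b) = exp (p * A + r * B) * exp (p * (a - A) + r * (b - B))"
    by (simp add: exp_add [symmetric] algebra_simps)
  ultimately show ?thesis by simp
qed

text \<open>
  Hoelder's inequality for the exponents \<open>1/p\<close> and \<open>1/r\<close>, in the form in which it is used below.
  Convexity of the exponential, applied after subtracting \<open>A\<close> and \<open>B\<close>, suffices for it.
\<close>

lemma (in prob_space) nn_integral_exp_combination_le:
  assumes [measurable]: "X \<in> borel_measurable M" "Y \<in> borel_measurable M"
    and X: "(\<integral>\<^sup>+\<omega>. ennreal (exp (X \<omega>)) \<partial>M) \<le> ennreal (exp A)"
    and Y: "(\<integral>\<^sup>+\<omega>. ennreal (exp (Y \<omega>)) \<partial>M) \<le> ennreal (exp B)"
    and pr: "0 \<le> p" "0 \<le> r" "p + r = 1"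
  shows "(\<integral>\<^sup>+\<omega>. ennreal (exp (p * X \<omega> + r * Y \<omega>)) \<partial>M) \<le> ennreal (exp (p * A + r * B))"
proof -
  define C where "C = exp (p * A + r * B)"
  define p' where "p' = C * p * exp (- A)"
  define r' where "r' = C * r * exp (- B)"
  have p'r': "0 \<le> p'" "0 \<le> r'" using pr by (simp_all add: p'_def r'_def C_def)
  have "(\<integral>\<^sup>+\<omega>. ennreal (exp (p * X \<omega> + r * Y \<omega>)) \<partial>M)
      \<le> (\<integral>\<^sup>+\<omega>. ennreal p' * ennreal (exp (X \<omega>)) + ennreal r' * ennreal (exp (Y \<omega>)) \<partial>M)"
  proof (intro nn_integral_mono)
    fix \<omega>
    have "exp (p * X \<omega> + r * Y \<omega>) \<le> p' * exp (X \<omega>) + r' * exp (Y \<omega>)"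
      using exp_convex_combination_le [OF pr, of "X \<omega>" "Y \<omega>" A B]
      by (simp add: p'_def r'_def C_def exp_diff exp_minus field_simps)
    then show "ennreal (exp (p * X \<omega> + r * Y \<omega>))
        \<le> ennreal p' * ennreal (exp (X \<omega>)) + ennreal r' * ennreal (exp (Y \<omega>))"
      using p'r' by (simp add: ennreal_mult [symmetric] ennreal_plus [symmetric] del: ennreal_plus)
  qed
  also have "\<dots> = ennreal p' * (\<integral>\<^sup>+\<omega>. ennreal (exp (X \<omega>)) \<partial>M) + ennreal r' * (\<integral>\<^sup>+\<omega>. ennreal (exp (Y \<omega>)) \<partial>M)"
    by (simp add: nn_integral_add nn_integral_cmult)
  also have "\<dots> \<le> ennreal p' * ennreal (exp A) + ennreal r' * ennreal (exp B)"
    by (intro add_mono mult_left_mono X Y) auto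
  also have "\<dots> = ennreal (p' * exp A + r' * exp B)"
    using p'r' by (simp add: ennreal_mult [symmetric] ennreal_plus [symmetric] del: ennreal_plus)
  also have "p' * exp A + r' * exp B = C * (p + r)"
    by (simp add: p'_def r'_def exp_minus field_simps)
  finally show ?thesis by (simp add: pr C_def)
qed

text \<open>
  All that the estimates use of the distribution of a normalized row of the random matrix.
\<close>

definition unit_forms_subgaussian :: "'w measure \<Rightarrow> ('w \<Rightarrow> 'a :: euclidean_space) \<Rightarrow> bool" where
  "unit_forms_subgaussian M g \<longleftrightarrow> g \<in> borel_measurable M \<and>
     (\<forall>u. norm u = 1 \<longrightarrow> subgaussian_square M (\<lambda>\<omega>. g \<omega> \<bullet> u) 1)"

text \<open>
  Hoelder's inequality with the weights \<open>(1 + \<rho>)/2\<close> and \<open>(1 - \<rho>)/2\<close> of the polarization identity,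
  \<open>\<rho> = \<langle>u, v\<rangle>\<close>.  The square with positive sign contributes \<open>l + l\<^sup>2 + log_mgf_excess l\<close>, the one with
  negative sign only \<open>- l + l\<^sup>2\<close>; hence the factor in front of the excess.
\<close>

lemma (in prob_space) mgf_product_of_forms:
  assumes g: "unit_forms_subgaussian M g"
    and uv: "norm u = 1" "norm v = 1" and l: "0 \<le> l" "l < 1 / 2"
  shows "(\<integral>\<^sup>+\<omega>. ennreal (exp (l * ((g \<omega> \<bullet> u) * (g \<omega> \<bullet> v)))) \<partial>M)
    \<le> ennreal (exp (l * (u \<bullet> v) + l\<^sup>2 + (1 + u \<bullet> v) / 2 * log_mgf_excess l))"
proof -
  have [measurable]: "g \<in> borel_measurable M"
    using g by (simp add: unit_forms_subgaussian_def)
  obtain e f where ef: "norm e = 1" "norm f = 1"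
    and split: "\<And>g. (g \<bullet> u) * (g \<bullet> v)
       = (1 + u \<bullet> v) / 2 * (g \<bullet> e)\<^sup>2 - (1 - u \<bullet> v) / 2 * (g \<bullet> f)\<^sup>2"
    by (rule inner_mult_inner_diff_squares [OF uv]) blast
  have uv1: "\<bar>u \<bullet> v\<bar> \<le> 1" using Cauchy_Schwarz_ineq2 [of u v] uv by simp
  have "(\<integral>\<^sup>+\<omega>. ennreal (exp ((1 + u \<bullet> v) / 2 * (l * (g \<omega> \<bullet> e)\<^sup>2)
                         + (1 - u \<bullet> v) / 2 * (- l * (g \<omega> \<bullet> f)\<^sup>2))) \<partial>M)
      \<le> ennreal (exp ((1 + u \<bullet> v) / 2 * (- ln (1 - 2 * l) / 2) + (1 - u \<bullet> v) / 2 * (- l + l\<^sup>2)))"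
  proof (rule nn_integral_exp_combination_le)
    have "subgaussian_square M (\<lambda>\<omega>. g \<omega> \<bullet> e) 1" "subgaussian_square M (\<lambda>\<omega>. g \<omega> \<bullet> f) 1"
      using g ef by (auto simp: unit_forms_subgaussian_def)
    then show "(\<integral>\<^sup>+\<omega>. ennreal (exp (l * (g \<omega> \<bullet> e)\<^sup>2)) \<partial>M) \<le> ennreal (exp (- ln (1 - 2 * l) / 2))"
      "(\<integral>\<^sup>+\<omega>. ennreal (exp (- l * (g \<omega> \<bullet> f)\<^sup>2)) \<partial>M) \<le> ennreal (exp (- l + l\<^sup>2))"
      using subgaussian_squareD_pos [of M _ 1 "2 * l" 0] subgaussian_squareD_neg [of M _ 1 "2 * l" 0] l
      by (fastforce simp: power_mult_distrib)+
  qed (use uv1 in \<open>auto simp: add_divide_distrib [symmetric]\<close>)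
  also have "(1 + u \<bullet> v) / 2 * (- ln (1 - 2 * l) / 2) + (1 - u \<bullet> v) / 2 * (- l + l\<^sup>2)
      = l * (u \<bullet> v) + l\<^sup>2 + (1 + u \<bullet> v) / 2 * log_mgf_excess l"
    by (simp add: log_mgf_excess_def field_simps)
  also have "(\<integral>\<^sup>+\<omega>. ennreal (exp ((1 + u \<bullet> v) / 2 * (l * (g \<omega> \<bullet> e)\<^sup>2)
                         + (1 - u \<bullet> v) / 2 * (- l * (g \<omega> \<bullet> f)\<^sup>2))) \<partial>M)
     = (\<integral>\<^sup>+\<omega>. ennreal (exp (l * ((g \<omega> \<bullet> u) * (g \<omega> \<bullet> v)))) \<partial>M)"
    by (intro nn_integral_cong) (simp add: split algebra_simps)
  finally show ?thesis .
qed

text \<open>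
  The indicator of \<open>X = 0\<close> is at most \<open>exp (- X\<^sup>2 / 2)\<close>, whose mean is bounded by the case
  \<open>\<eta> = 1\<close>, \<open>s = 0\<close> of the negative exponential moment.
\<close>

lemma (in prob_space) prob_form_eq_0_le:
  assumes g: "unit_forms_subgaussian M g" and v: "v \<noteq> 0"
  shows "prob {\<omega> \<in> space M. g \<omega> \<bullet> v = 0} \<le> exp (- 1 / 4)"
proof -
  have [measurable]: "g \<in> borel_measurable M"
    using g by (simp add: unit_forms_subgaussian_def)
  define X where "X = (\<lambda>\<omega>. g \<omega> \<bullet> sgn v)"
  have X: "subgaussian_square M X 1"
    using g v by (simp add: unit_forms_subgaussian_def norm_sgn X_def)
  have eq: "{\<omega> \<in> space M. g \<omega> \<bullet> v = 0} = {\<omega> \<in> space M. X \<omega> = 0}"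
    using v by (auto simp: X_def sgn_div_norm)
  have [measurable]: "{\<omega> \<in> space M. X \<omega> = 0} \<in> events" unfolding X_def by measurable
  have "emeasure M {\<omega> \<in> space M. X \<omega> = 0} = (\<integral>\<^sup>+\<omega>. indicator {\<omega> \<in> space M. X \<omega> = 0} \<omega> \<partial>M)"
    by simp
  also have "\<dots> \<le> (\<integral>\<^sup>+\<omega>. ennreal (exp (- 1 / 2 * (0 + X \<omega>)\<^sup>2)) \<partial>M)"
    by (intro nn_integral_mono) (auto simp: indicator_def)
  also have "\<dots> \<le> ennreal (exp (- 1 / 4))"
    using subgaussian_squareD_neg [OF X, of 1 0] by simp
  finally show ?thesis
    by (simp add: eq emeasure_eq_measure)
qed

section \<open>Concentration of inner products under a random matrix\<close>

lemma borel_measurable_vec_nth [measurable]: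
  "(\<lambda>x. x $ i) \<in> borel_measurable (borel :: ('a :: euclidean_space ^ 'n) measure)"
  by (rule borel_measurable_continuous_onI [OF linear_continuous_on [OF bounded_linear_vec_nth]])

lemma borel_measurable_vecI:
  fixes f :: "'w \<Rightarrow> 'a :: euclidean_space ^ 'n"
  assumes "\<And>i. (\<lambda>x. f x $ i) \<in> borel_measurable M"
  shows "f \<in> borel_measurable M"
proof (rule borel_measurable_euclidean_space [THEN iffD2], rule ballI)
  fix b :: "'a ^ 'n"
  assume "b \<in> Basis"
  then obtain i c where "b = axis i c" unfolding Basis_vec_def by blast
  then show "(\<lambda>x. f x \<bullet> b) \<in> borel_measurable M"
    using borel_measurable_inner [OF assms [of i] borel_measurable_const [of c]]
    by (simp only: inner_axis)
qed

lemma (in prob_space) independent_rows: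
  fixes A :: "'a \<Rightarrow> real ^ 'd ^ 'n"
  assumes "independent_entries M A"
  shows "indep_vars (\<lambda>_. borel) (\<lambda>i \<omega>. A \<omega> $ i) UNIV"
proof -
  define K where "K = (\<lambda>i :: 'n. {i} \<times> (UNIV :: 'd set))"
  define X where "X = (\<lambda>p \<omega>. A \<omega> $ fst p $ snd p)"
  have "indep_vars (\<lambda>_. borel) X UNIV"
    using assms by (simp add: independent_entries_def case_prod_unfold X_def)
  then have "indep_vars (\<lambda>i. PiM (K i) (\<lambda>_. borel)) (\<lambda>i \<omega>. restrict (\<lambda>p. X p \<omega>) (K i)) UNIV"
    by (rule indep_vars_restrict) (auto simp: disjoint_family_on_def K_def)
  then have "indep_vars (\<lambda>_. borel) (\<lambda>i \<omega>. (\<chi> j. restrict (\<lambda>p. X p \<omega>) (K i) (i, j))) UNIV"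
  proof (rule indep_vars_compose2)
    fix i
    show "(\<lambda>f :: 'n \<times> 'd \<Rightarrow> real. \<chi> j. f (i, j)) \<in> borel_measurable (PiM (K i) (\<lambda>_. borel))"
    proof (rule borel_measurable_vecI)
      fix j
      have "(\<lambda>f :: 'n \<times> 'd \<Rightarrow> real. f (i, j)) \<in> borel_measurable (PiM (K i) (\<lambda>_. borel))"
        by (rule measurable_component_singleton) (simp add: K_def)
      then show "(\<lambda>f :: 'n \<times> 'd \<Rightarrow> real. (\<chi> j. f (i, j)) $ j) \<in> borel_measurable (PiM (K i) (\<lambda>_. borel))"
        by simp
    qed
  qed
  moreover have "(\<lambda>i \<omega>. (\<chi> j. restrict (\<lambda>p. X p \<omega>) (K i) (i, j))) = (\<lambda>i \<omega>. A \<omega> $ i)"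
    by (simp add: fun_eq_iff vec_eq_iff K_def X_def)
  ultimately show ?thesis by simp
qed

lemma (in prob_space) entry_subgaussian_square:
  fixes A :: "'a \<Rightarrow> real ^ 'd ^ 'n"
  assumes "gaussian_matrix M A \<or> bernoulli_matrix M A"
  shows "subgaussian_square M (\<lambda>\<omega>. w * (sqrt (real CARD('n)) * A \<omega> $ i $ j)) (w\<^sup>2)"
  using assms
proof
  let ?r = "sqrt (real CARD('n))"
  assume A: "gaussian_matrix M A"
  then have "distributed M lborel (\<lambda>\<omega>. 0 + ?r * A \<omega> $ i $ j) (normal_density (0 + ?r * 0) (\<bar>?r\<bar> * (1 / ?r)))"
    by (intro normal_density_affine) (auto simp: gaussian_matrix_def)
  then show ?thesis
    by (intro gaussian_subgaussian_square) simp
next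
  let ?r = "sqrt (real CARD('n))"
  assume A: "bernoulli_matrix M A"
  then have "indep_vars (\<lambda>_. borel) (\<lambda>p \<omega>. A \<omega> $ fst p $ snd p) UNIV"
    unfolding bernoulli_matrix_def independent_entries_def by (simp add: case_prod_unfold)
  then have "(\<lambda>\<omega>. A \<omega> $ fst (i, j) $ snd (i, j)) \<in> borel_measurable M"
    unfolding indep_vars_def by blast
  then have [measurable]: "(\<lambda>\<omega>. A \<omega> $ i $ j) \<in> borel_measurable M"
    by simp
  have r: "0 < ?r" by simp
  have "{\<omega> \<in> space M. ?r * A \<omega> $ i $ j = 1} = {\<omega> \<in> space M. A \<omega> $ i $ j = 1 / ?r}"
    "{\<omega> \<in> space M. ?r * A \<omega> $ i $ j = - 1} = {\<omega> \<in> space M. A \<omega> $ i $ j = - 1 / ?r}"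
    using r by (metis (no_types, lifting) mult.commute nonzero_eq_divide_eq less_irrefl)+
  then show ?thesis
    using A by (intro two_point_subgaussian_square) (simp_all only: bernoulli_matrix_def, measurable)
qed

lemma (in prob_space) row_unit_forms_subgaussian:
  fixes A :: "'a \<Rightarrow> real ^ 'd ^ 'n"
  assumes A: "gaussian_matrix M A \<or> bernoulli_matrix M A"
  shows "unit_forms_subgaussian M (\<lambda>\<omega>. sqrt (real CARD('n)) *\<^sub>R (A \<omega> $ i))"
  unfolding unit_forms_subgaussian_def
proof (intro conjI allI impI)
  let ?r = "sqrt (real CARD('n))"
  have ind: "indep_vars (\<lambda>_. borel) (\<lambda>p \<omega>. A \<omega> $ fst p $ snd p) UNIV"
    using A unfolding gaussian_matrix_def bernoulli_matrix_def independent_entries_def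
    by (auto simp: case_prod_unfold)
  then show "(\<lambda>\<omega>. ?r *\<^sub>R (A \<omega> $ i)) \<in> borel_measurable M"
    by (intro borel_measurable_scaleR borel_measurable_const borel_measurable_vecI)
      (simp add: indep_vars_def)
  fix u :: "real ^ 'd"
  assume u: "norm u = 1"
  have "subgaussian_square M (\<lambda>\<omega>. \<Sum>p\<in>{i} \<times> UNIV. u $ snd p * (?r * A \<omega> $ fst p $ snd p))
      (\<Sum>p\<in>{i} \<times> (UNIV :: 'd set). (u $ snd p)\<^sup>2)"
  proof (rule subgaussian_square_sum)
    show "indep_vars (\<lambda>_. borel) (\<lambda>p \<omega>. u $ snd p * (?r * A \<omega> $ fst p $ snd p)) ({i} \<times> UNIV)"
      by (rule indep_vars_compose2 [OF indep_vars_subset [OF ind]]) auto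
    show "subgaussian_square M (\<lambda>\<omega>. u $ snd p * (?r * A \<omega> $ fst p $ snd p)) ((u $ snd p)\<^sup>2)"
      for p by (rule entry_subgaussian_square [OF A])
  qed auto
  moreover have "(\<Sum>p\<in>{i} \<times> UNIV. u $ snd p * (?r * A \<omega> $ fst p $ snd p)) = (?r *\<^sub>R (A \<omega> $ i)) \<bullet> u" for \<omega>
    by (simp add: sum.cartesian_product' inner_vec_def sum_distrib_left algebra_simps)
  moreover have "(\<Sum>p\<in>{i} \<times> (UNIV :: 'd set). (u $ snd p)\<^sup>2) = 1"
    using u by (simp add: sum.cartesian_product' norm_vec_def L2_set_def)
  ultimately show "subgaussian_square M (\<lambda>\<omega>. (?r *\<^sub>R (A \<omega> $ i)) \<bullet> u) 1" by simp
qed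

lemma prod_mono_ennreal:
  fixes f g :: "'i \<Rightarrow> ennreal"
  assumes "\<And>i. i \<in> I \<Longrightarrow> f i \<le> g i"
  shows "(\<Prod>i\<in>I. f i) \<le> (\<Prod>i\<in>I. g i)"
  using assms by (induction I rule: infinite_finite_induct) (auto intro: mult_mono)

text \<open>
  Since \<open>n \<langle>A u, A v\<rangle>\<close> is the sum over the rows of independent products of linear forms, the
  exponential moments multiply.  The lower tail is the case of \<open>- v\<close> in place of \<open>v\<close>, in which the excess is
  weighted by \<open>(1 - \<langle>u, v\<rangle>)/2\<close>.
\<close>

lemma (in prob_space) chernoff_compressed_inner:
  fixes A :: "'a \<Rightarrow> real ^ 'd ^ 'n"
  assumes A: "gaussian_matrix M A \<or> bernoulli_matrix M A"
    and uv: "norm u = 1" "norm v = 1" and l: "0 \<le> l" "l < 1 / 2"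
  shows "prob {\<omega> \<in> space M. c \<le> (A \<omega> *v u) \<bullet> (A \<omega> *v v)}
    \<le> exp (real CARD('n) * (l * (u \<bullet> v - c) + l\<^sup>2 + (1 + u \<bullet> v) / 2 * log_mgf_excess l))"
proof -
  let ?n = "real CARD('n)" and ?r = "sqrt (real CARD('n))"
  let ?h = "l * (u \<bullet> v) + l\<^sup>2 + (1 + u \<bullet> v) / 2 * log_mgf_excess l"
  define g where "g = (\<lambda>i \<omega>. ?r *\<^sub>R (A \<omega> $ i))"
  have g: "unit_forms_subgaussian M (g i)" for i
    unfolding g_def by (rule row_unit_forms_subgaussian [OF A])
  then have [measurable]: "g i \<in> borel_measurable M" for i
    by (simp add: unit_forms_subgaussian_def)
  have Ag: "?n * ((A \<omega> *v u) \<bullet> (A \<omega> *v v)) = (\<Sum>i\<in>UNIV. (g i \<omega> \<bullet> u) * (g i \<omega> \<bullet> v))" for \<omega>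
  proof -
    have "(g i \<omega> \<bullet> u) * (g i \<omega> \<bullet> v) = ?n * ((A \<omega> $ i \<bullet> u) * (A \<omega> $ i \<bullet> v))" for i
      by (simp add: g_def)
    then show ?thesis
      by (simp add: inner_vec_def [of "A \<omega> *v u"] matrix_vector_mul_component sum_distrib_left)
  qed
  have "indep_vars (\<lambda>_. borel) (\<lambda>i \<omega>. A \<omega> $ i) UNIV"
    using A by (intro independent_rows) (auto simp: gaussian_matrix_def bernoulli_matrix_def)
  then have ind: "indep_vars (\<lambda>_. borel) (\<lambda>i \<omega>. ennreal (exp (l * ((g i \<omega> \<bullet> u) * (g i \<omega> \<bullet> v))))) UNIV"
    unfolding g_def
    by (rule indep_vars_compose2 [where Y = "\<lambda>_ a. ennreal (exp (l * (((?r *\<^sub>R a) \<bullet> u) * ((?r *\<^sub>R a) \<bullet> v))))"])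
      measurable
  have mgf: "(\<integral>\<^sup>+\<omega>. ennreal (exp (l * ((g i \<omega> \<bullet> u) * (g i \<omega> \<bullet> v)))) \<partial>M) \<le> ennreal (exp ?h)" for i
    by (rule mgf_product_of_forms [OF g uv l])
  let ?E = "{\<omega> \<in> space M. c \<le> (A \<omega> *v u) \<bullet> (A \<omega> *v v)}"
  have E_eq: "?E = {\<omega> \<in> space M. ?n * c \<le> (\<Sum>i\<in>UNIV. (g i \<omega> \<bullet> u) * (g i \<omega> \<bullet> v))}"
    unfolding Ag [symmetric] by auto
  have [measurable]: "?E \<in> events" unfolding E_eq by measurable
  have "emeasure M ?E = (\<integral>\<^sup>+\<omega>. indicator ?E \<omega> \<partial>M)"
    by simp
  also have "\<dots> \<le> (\<integral>\<^sup>+\<omega>. ennreal (exp (- (l * (?n * c))))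
      * (\<Prod>i\<in>UNIV. ennreal (exp (l * ((g i \<omega> \<bullet> u) * (g i \<omega> \<bullet> v))))) \<partial>M)"
  proof (intro nn_integral_mono)
    fix \<omega>
    have "(\<Prod>i\<in>UNIV. ennreal (exp (l * ((g i \<omega> \<bullet> u) * (g i \<omega> \<bullet> v)))))
        = ennreal (exp (l * (\<Sum>i\<in>UNIV. (g i \<omega> \<bullet> u) * (g i \<omega> \<bullet> v))))"
      by (simp add: prod_ennreal exp_sum sum_distrib_left)
    then have "ennreal (exp (- (l * (?n * c)))) * (\<Prod>i\<in>UNIV. ennreal (exp (l * ((g i \<omega> \<bullet> u) * (g i \<omega> \<bullet> v)))))
        = ennreal (exp (l * ((\<Sum>i\<in>UNIV. (g i \<omega> \<bullet> u) * (g i \<omega> \<bullet> v)) - ?n * c)))"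
      by (simp add: ennreal_mult [symmetric] exp_add [symmetric] algebra_simps)
    moreover have "\<omega> \<in> ?E \<Longrightarrow> 0 \<le> l * ((\<Sum>i\<in>UNIV. (g i \<omega> \<bullet> u) * (g i \<omega> \<bullet> v)) - ?n * c)"
      using l unfolding E_eq by auto
    ultimately show "indicator ?E \<omega> \<le> ennreal (exp (- (l * (?n * c))))
      * (\<Prod>i\<in>UNIV. ennreal (exp (l * ((g i \<omega> \<bullet> u) * (g i \<omega> \<bullet> v)))))"
      by (auto simp: indicator_def)
  qed
  also have "\<dots> = ennreal (exp (- (l * (?n * c))))
      * (\<Prod>i\<in>UNIV. \<integral>\<^sup>+\<omega>. ennreal (exp (l * ((g i \<omega> \<bullet> u) * (g i \<omega> \<bullet> v)))) \<partial>M)"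
    by (subst nn_integral_cmult) (auto simp: indep_vars_nn_integral [OF _ ind])
  also have "\<dots> \<le> ennreal (exp (- (l * (?n * c)))) * (\<Prod>i\<in>(UNIV :: 'n set). ennreal (exp ?h))"
    by (intro mult_left_mono prod_mono_ennreal mgf) simp
  also have "\<dots> = ennreal (exp (- (l * (?n * c))) * exp ?h ^ CARD('n))"
    by (simp add: ennreal_mult ennreal_power)
  also have "exp (- (l * (?n * c))) * exp ?h ^ CARD('n) = exp (- (l * (?n * c)) + ?n * ?h)"
    by (simp only: exp_add exp_of_nat_mult)
  also have "- (l * (?n * c)) + ?n * ?h
      = ?n * (l * (u \<bullet> v - c) + l\<^sup>2 + (1 + u \<bullet> v) / 2 * log_mgf_excess l)"
    by (simp add: algebra_simps)
  finally show ?thesis by (simp add: emeasure_eq_measure)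
qed

section \<open>Rows of a random matrix that annihilate a subspace\<close>

text \<open>
  The matrices whose rows indexed by \<open>J\<close> do not separate the points of \<open>V\<close>.
\<close>

definition annihilating :: "'v::euclidean_space set \<Rightarrow> 'n set \<Rightarrow> ('v ^ 'n) set" where
  "annihilating V J = {B. \<exists>v\<in>V - {0}. \<forall>k\<in>J. B $ k \<bullet> v = 0}"

text \<open>
  The annihilated vector can be taken in the unit sphere of \<open>V\<close>, which is compact, so that
  projecting along it preserves closedness.  This gives the measurability of the corresponding event.
\<close>

lemma closed_annihilating:
  fixes V :: "'v::euclidean_space set" and J :: "'n::finite set"
  assumes V: "subspace V"
  shows "closed (annihilating V J)"
proof -
  have "compact (V \<inter> sphere 0 1)"
    using closed_Int_compact [OF closed_subspace [OF V] compact_sphere] .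
  moreover have "closed {p :: 'v \<times> ('v ^ 'n). \<forall>k\<in>J. snd p $ k \<bullet> fst p = 0}"
    unfolding Ball_def
    by (intro closed_Collect_all closed_Collect_imp closed_Collect_eq continuous_intros) simp
  ultimately have "closed {B :: 'v ^ 'n. \<exists>v. v \<in> V \<inter> sphere 0 1
      \<and> (v, B) \<in> {p. \<forall>k\<in>J. snd p $ k \<bullet> fst p = 0}}"
    by (rule closed_compact_projection)
  also have "{B :: 'v ^ 'n. \<exists>v. v \<in> V \<inter> sphere 0 1 \<and> (v, B) \<in> {p. \<forall>k\<in>J. snd p $ k \<bullet> fst p = 0}}
      = annihilating V J"
    unfolding annihilating_def
  proof (intro Collect_cong iffI)
    fix B :: "'v ^ 'n"
    assume "\<exists>v\<in>V - {0}. \<forall>k\<in>J. B $ k \<bullet> v = 0"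
    then obtain v where "v \<in> V" "v \<noteq> 0" "\<forall>k\<in>J. B $ k \<bullet> v = 0" by blast
    then have "sgn v \<in> V \<inter> sphere 0 1" "\<forall>k\<in>J. B $ k \<bullet> sgn v = 0"
      using V by (auto simp: norm_sgn sgn_div_norm subspace_scale)
    then show "\<exists>v. v \<in> V \<inter> sphere 0 1 \<and> (v, B) \<in> {p. \<forall>k\<in>J. snd p $ k \<bullet> fst p = 0}"
      by auto
  next
    fix B :: "'v ^ 'n"
    assume "\<exists>v. v \<in> V \<inter> sphere 0 1 \<and> (v, B) \<in> {p. \<forall>k\<in>J. snd p $ k \<bullet> fst p = 0}"
    then obtain v where "v \<in> V" "norm v = 1" "\<forall>k\<in>J. B $ k \<bullet> v = 0" by auto
    then show "\<exists>v\<in>V - {0}. \<forall>k\<in>J. B $ k \<bullet> v = 0" by (intro bexI [of _ v]) auto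
  qed
  finally show ?thesis .
qed

text \<open>
  Induction on the set of rows, uniformly in the subspace.  Given the row \<open>i\<close>, the remaining rows must
  annihilate a nonzero vector of \<open>W\<close>, the part of \<open>V\<close> orthogonal to that row.  Fix a nonzero \<open>v \<in> V\<close>.  Unless the row \<open>i\<close> is orthogonal to \<open>v\<close>, which
  has probability at most \<open>q\<close>, the dimension of \<open>W\<close> is smaller than that of \<open>V\<close>, and the induction
  hypothesis gains a factor 2.  On average the bound is thus multiplied by at most \<open>(1 + q)/2\<close>.
\<close>

lemma (in prob_space) prob_rows_annihilate_le:
  fixes r :: "'n::finite \<Rightarrow> 'a \<Rightarrow> 'v::euclidean_space"
  assumes ind: "indep_vars (\<lambda>_. borel) r UNIV"
    and q: "0 \<le> q" "\<And>k v. v \<noteq> 0 \<Longrightarrow> prob {\<omega> \<in> space M. r k \<omega> \<bullet> v = 0} \<le> q"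
    and V: "subspace V"
  shows "prob {\<omega> \<in> space M. (\<chi> k. r k \<omega>) \<in> annihilating V J} \<le> 2 ^ dim V * ((1 + q) / 2) ^ card J"
  using finite [of J] V
proof (induction J arbitrary: V rule: finite_induct)
  case empty
  show ?case using order_trans [OF prob_le_1 one_le_power [of "2 :: real" "dim V"]] by simp
next
  case (insert i J)
  have r [measurable]: "r k \<in> borel_measurable M" for k
    using ind by (simp add: indep_vars_def)
  define R where "R = (\<lambda>\<omega>. \<chi> k. r k \<omega>)"
  have R [measurable]: "R \<in> borel_measurable M"
    unfolding R_def by (intro borel_measurable_vecI) simp
  have cl: "annihilating W K \<in> sets borel" if "subspace W" for W :: "'v set" and K :: "'n set"
    using closed_annihilating [OF that] by (rule borel_closed)
  define c where "c = ((1 + q) / 2) ^ card J"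
  have c: "0 \<le> c" using q(1) by (simp add: c_def)
  let ?E = "{\<omega> \<in> space M. R \<omega> \<in> annihilating V (insert i J)}"
  show ?case
  proof (cases "V \<subseteq> {0}")
    case True
    then have "annihilating V (insert i J) = {}" by (auto simp: annihilating_def)
    then show ?thesis using q(1) by simp
  next
    case False
    then obtain v where v: "v \<in> V" "v \<noteq> 0" by auto
    obtain D where D: "dim V = Suc D"
      using False dim_eq_0 [of V] by (cases "dim V") auto
    define Z where "Z = {\<omega> \<in> space M. r i \<omega> \<bullet> v = 0}"
    have [measurable]: "Z \<in> events" unfolding Z_def by measurable
    \<comment> \<open>The row \<open>i\<close> and the other rows, as independent random matrices with zeros in the remaining rows;
      their sum has the rows \<open>insert i J\<close> of \<open>R\<close>.\<close>
    define part where "part = (\<lambda>K \<omega>. \<chi> k. if k \<in> K then r k \<omega> else 0)"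
    have ind_parts: "indep_var borel (part {i}) borel (part J)"
    proof -
      let ?m = "\<lambda>K f. \<chi> k. if k \<in> K then f k else (0 :: 'v)"
      have m: "?m K \<in> borel_measurable (PiM K (\<lambda>_. borel))" for K :: "'n set"
      proof (rule borel_measurable_vecI)
        fix k
        show "(\<lambda>f. ?m K f $ k) \<in> borel_measurable (PiM K (\<lambda>_. borel))"
          by (cases "k \<in> K") simp_all
      qed
      have "indep_var (PiM {i} (\<lambda>_. borel)) (\<lambda>\<omega>. restrict (\<lambda>k. r k \<omega>) {i})
          (PiM J (\<lambda>_. borel)) (\<lambda>\<omega>. restrict (\<lambda>k. r k \<omega>) J)"
        using insert by (intro indep_var_restrict [OF ind]) auto
      note indep_var_compose [OF this m m]
      moreover have "?m K \<circ> (\<lambda>\<omega>. restrict (\<lambda>k. r k \<omega>) K) = part K" for K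
        by (simp add: part_def fun_eq_iff vec_eq_iff)
      ultimately show ?thesis by (simp only:)
    qed
    have sum_meas: "(\<lambda>(B, C). indicator (annihilating V (insert i J)) (B + C) :: ennreal)
        \<in> borel_measurable (borel \<Otimes>\<^sub>M borel)"
    proof -
      have "(\<lambda>p. fst p + snd p) \<in> borel \<Otimes>\<^sub>M borel \<rightarrow>\<^sub>M (borel :: ('v ^ 'n) measure)"
        by measurable
      from measurable_compose [OF this borel_measurable_indicator [OF cl [OF \<open>subspace V\<close>]]]
      show ?thesis by (simp add: case_prod_unfold)
    qed
    have sub: "subspace (V \<inter> {w. x \<bullet> w = 0})" for x
      using \<open>subspace V\<close> subspace_hyperplane by (intro subspace_inter)
    have part_iff: "part {i} \<omega> + part J \<omega>' \<in> annihilating V (insert i J)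
        \<longleftrightarrow> R \<omega>' \<in> annihilating (V \<inter> {w. r i \<omega> \<bullet> w = 0}) J" for \<omega> \<omega>'
      using insert(2) by (auto simp: part_def R_def annihilating_def)
    have "emeasure M ?E = (\<integral>\<^sup>+\<omega>. indicator (annihilating V (insert i J)) (part {i} \<omega> + part J \<omega>) \<partial>M)"
    proof -
      have "R \<omega> \<in> annihilating V (insert i J) \<longleftrightarrow> part {i} \<omega> + part J \<omega> \<in> annihilating V (insert i J)" for \<omega>
        unfolding part_iff by (auto simp: annihilating_def R_def)
      then have "(\<integral>\<^sup>+\<omega>. indicator (annihilating V (insert i J)) (part {i} \<omega> + part J \<omega>) \<partial>M)
          = (\<integral>\<^sup>+\<omega>. indicator ?E \<omega> \<partial>M)"
        by (intro nn_integral_cong) (simp add: indicator_def)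
      also have "?E \<in> events"
        using measurable_sets [OF R cl [OF \<open>subspace V\<close>]] by (simp add: vimage_def Int_def conj_commute)
      ultimately show ?thesis by simp
    qed
    also have "\<dots> = (\<integral>\<^sup>+\<omega>. \<integral>\<^sup>+\<omega>'. indicator (annihilating V (insert i J)) (part {i} \<omega> + part J \<omega>') \<partial>M \<partial>M)"
      by (rule nn_integral_indep_var [OF ind_parts sum_meas])
    also have "\<dots> \<le> (\<integral>\<^sup>+\<omega>. ennreal (2 ^ D * c) + ennreal (2 ^ D * c) * indicator Z \<omega> \<partial>M)"
    proof (intro nn_integral_mono)
      fix \<omega>
      assume \<omega>: "\<omega> \<in> space M"
      let ?W = "V \<inter> {w. r i \<omega> \<bullet> w = 0}"
      have ev: "{\<omega>' \<in> space M. R \<omega>' \<in> annihilating ?W J} \<in> events"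
        using measurable_sets [OF R cl [OF sub]] by (simp add: vimage_def Int_def conj_commute)
      have "(\<integral>\<^sup>+\<omega>'. indicator (annihilating V (insert i J)) (part {i} \<omega> + part J \<omega>') \<partial>M)
          = (\<integral>\<^sup>+\<omega>'. indicator {\<omega>' \<in> space M. R \<omega>' \<in> annihilating ?W J} \<omega>' \<partial>M)"
        by (intro nn_integral_cong) (simp add: indicator_def part_iff)
      also have "\<dots> = ennreal (prob {\<omega>' \<in> space M. R \<omega>' \<in> annihilating ?W J})"
        using ev by (simp add: emeasure_eq_measure)
      also have "\<dots> \<le> ennreal (2 ^ dim ?W * c)"
        unfolding c_def R_def by (intro ennreal_leI insert.IH sub)
      also have "\<dots> \<le> ennreal (2 ^ D * c) + ennreal (2 ^ D * c) * indicator Z \<omega>"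
      proof (cases "\<omega> \<in> Z")
        case True
        have "(2 :: real) ^ dim ?W * c \<le> 2 ^ Suc D * c"
          using c D dim_subset [of ?W V] by (intro mult_right_mono power_increasing) auto
        then show ?thesis
          using True c by (simp add: ennreal_plus [symmetric] algebra_simps del: ennreal_plus)
      next
        case False
        then have "v \<notin> ?W" using \<omega> by (simp add: Z_def)
        then have "?W \<subset> V" using v by blast
        then have "dim ?W < dim V"
          using sub \<open>subspace V\<close> by (intro dim_psubset) (metis span_eq_iff)
        then have "(2 :: real) ^ dim ?W * c \<le> 2 ^ D * c"
          using c D by (intro mult_right_mono power_increasing) auto
        then show ?thesis
          using False by (simp add: ennreal_leI)
      qed
      finally show "(\<integral>\<^sup>+\<omega>'. indicator (annihilating V (insert i J)) (part {i} \<omega> + part J \<omega>') \<partial>M)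
          \<le> ennreal (2 ^ D * c) + ennreal (2 ^ D * c) * indicator Z \<omega>" .
    qed
    also have "\<dots> = ennreal (2 ^ D * c) + ennreal (2 ^ D * c) * ennreal (prob Z)"
      by (simp add: nn_integral_add nn_integral_cmult emeasure_eq_measure prob_space)
    also have "\<dots> = ennreal (2 ^ D * c * (1 + prob Z))"
      using c by (simp add: ennreal_mult [symmetric] ennreal_plus [symmetric] algebra_simps del: ennreal_plus)
    also have "\<dots> \<le> ennreal (2 ^ D * c * (1 + q))"
      using c q(2) [OF v(2), of i] by (intro ennreal_leI mult_left_mono) (auto simp: Z_def)
    also have "2 ^ D * c * (1 + q) = 2 ^ dim V * ((1 + q) / 2) ^ card (insert i J)"
      using insert by (simp add: D c_def)
    finally show ?thesis
      using q(1) by (simp add: emeasure_eq_measure R_def)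
  qed
qed

section \<open>The pseudo-inverse and exact recovery by thresholding\<close>

text \<open>
  If \<open>transpose A\<close> annihilates \<open>A d\<close>, then \<open>\<parallel>A d\<parallel>\<^sup>2 = \<langle>transpose A (A d), d\<rangle> = 0\<close>.
\<close>

lemma matrix_mul_transpose_self_cancel:
  fixes A :: "real ^ 'k ^ 'm" and Y Z :: "real ^ 'l ^ 'k"
  assumes "transpose A ** A ** Y = transpose A ** A ** Z"
  shows "A ** Y = A ** Z"
  unfolding matrix_eq
proof
  fix w
  define d where "d = Y *v w - Z *v w"
  have "transpose A *v (A *v d) = (transpose A ** A ** Y) *v w - (transpose A ** A ** Z) *v w"
    by (simp only: d_def matrix_vector_mult_diff_distrib matrix_vector_mul_assoc matrix_mul_assoc)
  then have "transpose A *v (A *v d) = 0" using assms by simp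
  moreover have "(norm (A *v d))\<^sup>2 = (transpose A *v (A *v d)) \<bullet> d"
    by (metis dot_lmul_matrix transpose_matrix_vector power2_norm_eq_inner)
  ultimately have "A *v d = 0" by simp
  then show "(A ** Y) *v w = (A ** Z) *v w"
    by (simp add: d_def matrix_vector_mult_diff_distrib matrix_vector_mul_assoc)
qed

lemma ex_generalized_inverse:
  fixes N :: "real ^ 'k ^ 'm"
  shows "\<exists>G. N ** G ** N = N"
proof -
  obtain g where g: "linear g" "\<forall>v\<in>range ((*v) N). N *v g v = v"
    using linear_exists_right_inverse_on [OF matrix_vector_mul_linear [of N] subspace_UNIV] by blast
  have "N ** matrix g ** N = N"
    unfolding matrix_eq
    using g by (simp add: matrix_vector_mul_assoc [symmetric] matrix_works)
  then show ?thesis ..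
qed

text \<open>
  Here \<open>A L\<close> is the orthogonal projection onto the range of \<open>A\<close>.  It is obtained from a generalized inverse
  \<open>G\<close> of the Gram matrix \<open>transpose A ** A\<close> as \<open>L = G ** transpose A\<close>.
\<close>

lemma ex_symmetric_left_factor:
  fixes A :: "real ^ 'k ^ 'm"
  shows "\<exists>L. A ** L ** A = A \<and> transpose (A ** L) = A ** L"
proof -
  define N where "N = transpose A ** A"
  obtain G where G: "N ** G ** N = N" using ex_generalized_inverse by blast
  have N_sym: "transpose N = N" by (simp add: N_def matrix_transpose_mul)
  have "transpose A ** A ** (G ** N) = transpose A ** A ** mat 1"
    using G by (simp add: N_def matrix_mul_assoc)
  then have AGN: "A ** G ** N = A"
    using matrix_mul_transpose_self_cancel by (metis matrix_mul_assoc matrix_mul_rid)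
  then have NGA: "N ** transpose G ** transpose A = transpose A"
    by (metis N_sym matrix_mul_assoc matrix_transpose_mul)
  define Q where "Q = A ** (G ** transpose A)"
  have "Q = A ** G ** (N ** transpose G ** transpose A)"
    by (simp add: Q_def NGA matrix_mul_assoc)
  also have "\<dots> = Q ** transpose Q"
    by (simp add: Q_def N_def matrix_transpose_mul matrix_mul_assoc)
  finally have "transpose Q = Q" by (metis matrix_transpose_mul transpose_transpose)
  then show ?thesis
    using AGN by (intro exI [of _ "G ** transpose A"]) (simp add: Q_def N_def matrix_mul_assoc)
qed

text \<open>
  With projections \<open>A L\<close> onto the range of \<open>A\<close> and \<open>R A\<close> onto the range of \<open>transpose A\<close>, the matrix
  \<open>R A L\<close> satisfies the four Penrose equations.
\<close>

lemma ex_pseudo_inverse: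
  fixes A :: "real ^ 'k ^ 'm"
  shows "\<exists>C. is_pseudo_inverse A C"
proof -
  obtain L where L: "A ** L ** A = A" "transpose (A ** L) = A ** L"
    using ex_symmetric_left_factor by blast
  obtain L' where "transpose A ** L' ** transpose A = transpose A"
    "transpose (transpose A ** L') = transpose A ** L'"
    using ex_symmetric_left_factor by blast
  then obtain R where R: "A ** R ** A = A" "transpose (R ** A) = R ** A"
    by (metis matrix_mul_assoc matrix_transpose_mul transpose_transpose)
  have "A ** (R ** A ** L) = A ** L" "(R ** A ** L) ** A = R ** A"
    using L(1) R(1) by (metis matrix_mul_assoc)+
  then have "is_pseudo_inverse A (R ** A ** L)"
    unfolding is_pseudo_inverse_def using L R by (metis matrix_mul_assoc)
  then show ?thesis ..
qed

lemma pseudo_inverse_unique: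
  assumes B: "is_pseudo_inverse A B" and C: "is_pseudo_inverse A C"
  shows "B = C"
proof -
  have AB: "A ** B = A ** C"
  proof -
    have "A ** B = (A ** C) ** (A ** B)"
      using C by (metis is_pseudo_inverse_def matrix_mul_assoc)
    also have "\<dots> = transpose ((A ** B) ** (A ** C))"
      using B C by (simp add: is_pseudo_inverse_def matrix_transpose_mul)
    also have "(A ** B) ** (A ** C) = A ** C"
      using B by (metis is_pseudo_inverse_def matrix_mul_assoc)
    finally show ?thesis using C by (simp add: is_pseudo_inverse_def)
  qed
  have BA: "B ** A = C ** A"
  proof -
    have "B ** A = (B ** A) ** (C ** A)"
      using C by (metis is_pseudo_inverse_def matrix_mul_assoc)
    also have "\<dots> = transpose ((C ** A) ** (B ** A))"
      using B C by (simp add: is_pseudo_inverse_def matrix_transpose_mul)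
    also have "(C ** A) ** (B ** A) = C ** A"
      using B by (metis is_pseudo_inverse_def matrix_mul_assoc)
    finally show ?thesis using C by (simp add: is_pseudo_inverse_def)
  qed
  have "B = B ** A ** B" using B by (simp add: is_pseudo_inverse_def)
  also have "\<dots> = C ** A ** C" using AB BA by (metis matrix_mul_assoc)
  also have "\<dots> = C" using C by (simp add: is_pseudo_inverse_def)
  finally show ?thesis .
qed

lemma is_pseudo_inverse_pseudo_inverse: "is_pseudo_inverse B (pseudo_inverse B)"
  unfolding pseudo_inverse_def
  using ex_pseudo_inverse pseudo_inverse_unique by (metis theI)

lemma pseudo_inverse_mult_in_row_space:
  "\<exists>w. pseudo_inverse B *v s = transpose B *v w"
proof -
  let ?C = "pseudo_inverse B"
  have "?C = transpose B ** (transpose ?C ** ?C)"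
    using is_pseudo_inverse_pseudo_inverse [of B]
    by (metis is_pseudo_inverse_def matrix_mul_assoc matrix_transpose_mul)
  then have "?C *v s = transpose B *v ((transpose ?C ** ?C) *v s)"
    by (metis matrix_vector_mul_assoc)
  then show ?thesis ..
qed

text \<open>
  The product of the pseudo-inverse and \<open>B\<close> is the orthogonal projection onto the row space of \<open>B\<close>.  Membership
  in the row space, unlike the pseudo-inverse itself, depends on \<open>B\<close> in an evidently measurable way.
\<close>

lemma pseudo_inverse_recovers_iff:
  "pseudo_inverse B *v (B *v x) = x \<longleftrightarrow> (\<exists>w. transpose B *v w = x)"
proof
  assume "pseudo_inverse B *v (B *v x) = x"
  then show "\<exists>w. transpose B *v w = x"
    using pseudo_inverse_mult_in_row_space [of B "B *v x"] by metis
next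
  let ?C = "pseudo_inverse B"
  assume "\<exists>w. transpose B *v w = x"
  then obtain w where w: "x = transpose B *v w" by blast
  have "?C ** B ** transpose B = transpose (B ** ?C ** B)"
    using is_pseudo_inverse_pseudo_inverse [of B]
    by (metis is_pseudo_inverse_def matrix_mul_assoc matrix_transpose_mul)
  then have "?C ** B ** transpose B = transpose B"
    using is_pseudo_inverse_pseudo_inverse [of B] by (simp add: is_pseudo_inverse_def)
  then show "?C *v (B *v x) = x"
    by (simp only: w matrix_vector_mul_assoc matrix_mul_assoc)
qed

lemma pseudo_inverse_restrict_columns_outside:
  assumes "j \<notin> \<Lambda>"
  shows "(pseudo_inverse (restrict_columns B \<Lambda>) *v s) $ j = 0"
proof -
  obtain w where "pseudo_inverse (restrict_columns B \<Lambda>) *v s = transpose (restrict_columns B \<Lambda>) *v w"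
    using pseudo_inverse_mult_in_row_space by blast
  then show ?thesis
    using assms by (simp add: matrix_vector_mult_def transpose_def restrict_columns_def)
qed

lemma restrict_columns_mult_supported:
  assumes "\<And>j. j \<notin> \<Lambda> \<Longrightarrow> x $ j = 0"
  shows "restrict_columns B \<Lambda> *v x = B *v x"
  using assms by (auto simp: vec_eq_iff matrix_vector_mult_def restrict_columns_def intro!: sum.cong)

text \<open>
  An output computed from \<open>\<Lambda>'\<close> vanishes outside \<open>\<Lambda>'\<close>.  It can equal \<open>x\<close> only if \<open>\<Lambda>'\<close> contains the support
  \<open>\<Lambda>\<close>, hence, both having \<open>S\<close> elements, only if \<open>\<Lambda>' = \<Lambda>\<close>.
\<close>

lemma thresholding_recovers_iff:
  assumes \<Lambda>: "\<Lambda> = {i. x $ i \<noteq> 0}" "card \<Lambda> = S" and y: "y = \<Phi> *v x"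
  shows "thresholding_recovers \<Phi> S x y A \<longleftrightarrow>
     largest_correlations (A ** \<Phi>) S (A *v y) \<Lambda> \<and>
     (\<forall>\<Lambda>'. \<Lambda>' \<noteq> \<Lambda> \<longrightarrow> \<not> largest_correlations (A ** \<Phi>) S (A *v y) \<Lambda>') \<and>
     (\<exists>w. transpose (restrict_columns (A ** \<Phi>) \<Lambda>) *v w = x)"
proof -
  let ?out = "\<lambda>\<Lambda>'. pseudo_inverse (restrict_columns (A ** \<Phi>) \<Lambda>') *v (A *v y)"
  have s: "A *v y = restrict_columns (A ** \<Phi>) \<Lambda> *v x"
    by (subst restrict_columns_mult_supported) (auto simp: \<Lambda> y matrix_vector_mul_assoc)
  have own: "?out \<Lambda> = x \<longleftrightarrow> (\<exists>w. transpose (restrict_columns (A ** \<Phi>) \<Lambda>) *v w = x)"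
    unfolding s by (rule pseudo_inverse_recovers_iff)
  have other: "?out \<Lambda>' \<noteq> x" if "largest_correlations (A ** \<Phi>) S (A *v y) \<Lambda>'" "\<Lambda>' \<noteq> \<Lambda>" for \<Lambda>'
  proof
    assume "?out \<Lambda>' = x"
    then have "\<Lambda> \<subseteq> \<Lambda>'"
      using pseudo_inverse_restrict_columns_outside [of _ \<Lambda>' "A ** \<Phi>" "A *v y"] by (auto simp: \<Lambda>(1))
    moreover have "card \<Lambda>' = card \<Lambda>"
      using that \<Lambda>(2) by (simp add: largest_correlations_def)
    ultimately show False
      using that(2) card_subset_eq [of \<Lambda>' \<Lambda>] by simp
  qed
  have "thresholding_recovers \<Phi> S x y A \<longleftrightarrow> thresholding (A ** \<Phi>) S (A *v y) = {x}"
    by (auto simp: thresholding_recovers_def y)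
  also have "\<dots> \<longleftrightarrow> (\<exists>\<Lambda>'. largest_correlations (A ** \<Phi>) S (A *v y) \<Lambda>')
      \<and> (\<forall>\<Lambda>'. largest_correlations (A ** \<Phi>) S (A *v y) \<Lambda>' \<longrightarrow> ?out \<Lambda>' = x)"
    unfolding thresholding_def by blast
  finally show ?thesis
    using own other by metis
qed

lemma thresholding_recoversI:
  assumes \<Lambda>: "\<Lambda> = {i. x $ i \<noteq> 0}" "card \<Lambda> = S" and y: "y = \<Phi> *v x"
    and sep: "\<And>i j. i \<in> \<Lambda> \<Longrightarrow> j \<notin> \<Lambda> \<Longrightarrow>
      \<bar>(A *v y) \<bullet> column j (A ** \<Phi>)\<bar> < \<bar>(A *v y) \<bullet> column i (A ** \<Phi>)\<bar>"
    and inj: "\<And>z. (\<And>j. j \<notin> \<Lambda> \<Longrightarrow> z $ j = 0) \<Longrightarrow> (A ** \<Phi>) *v z = 0 \<Longrightarrow> z = 0"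
  shows "thresholding_recovers \<Phi> S x y A"
proof -
  let ?c = "\<lambda>i. \<bar>(A *v y) \<bullet> column i (A ** \<Phi>)\<bar>"
  have "largest_correlations (A ** \<Phi>) S (A *v y) \<Lambda>"
    using sep \<Lambda>(2) by (fastforce simp: largest_correlations_def)
  moreover have "\<not> largest_correlations (A ** \<Phi>) S (A *v y) \<Lambda>'" if "\<Lambda>' \<noteq> \<Lambda>" for \<Lambda>'
  proof
    assume l: "largest_correlations (A ** \<Phi>) S (A *v y) \<Lambda>'"
    then have card: "card \<Lambda>' = card \<Lambda>" using \<Lambda>(2) by (simp add: largest_correlations_def)
    then have "\<not> \<Lambda> \<subseteq> \<Lambda>'" "\<not> \<Lambda>' \<subseteq> \<Lambda>"
      using that card_subset_eq [of \<Lambda> \<Lambda>'] card_subset_eq [of \<Lambda>' \<Lambda>] by auto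
    then obtain i j where "i \<in> \<Lambda>" "i \<notin> \<Lambda>'" "j \<in> \<Lambda>'" "j \<notin> \<Lambda>"
      by blast
    then show False
      using l sep [of i j] by (fastforce simp: largest_correlations_def)
  qed
  moreover have "\<exists>w. transpose (restrict_columns (A ** \<Phi>) \<Lambda>) *v w = x"
  proof -
    let ?B = "restrict_columns (A ** \<Phi>) \<Lambda>"
    define z where "z = pseudo_inverse ?B *v (?B *v x) - x"
    have z: "z $ j = 0" if "j \<notin> \<Lambda>" for j
      using that pseudo_inverse_restrict_columns_outside [OF that] by (simp add: z_def \<Lambda>(1))
    have "(A ** \<Phi>) *v z = ?B *v z"
      using z by (simp add: restrict_columns_mult_supported)
    also have "\<dots> = (?B ** pseudo_inverse ?B ** ?B) *v x - ?B *v x"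
      by (simp add: z_def matrix_vector_mult_diff_distrib matrix_vector_mul_assoc matrix_mul_assoc)
    also have "\<dots> = 0"
      using is_pseudo_inverse_pseudo_inverse [of ?B] by (simp add: is_pseudo_inverse_def)
    finally have "z = 0" using z by (intro inj)
    then show ?thesis
      by (intro pseudo_inverse_recovers_iff [THEN iffD1]) (simp add: z_def)
  qed
  ultimately show ?thesis
    by (simp add: thresholding_recovers_iff [OF \<Lambda> y])
qed

lemma closed_row_space_bounded:
  "closed {B :: real ^ 'k ^ 'n. \<exists>w\<in>cball 0 r. transpose B *v w = x}"
proof -
  have "closed {p :: (real ^ 'n) \<times> (real ^ 'k ^ 'n). transpose (snd p) *v fst p = x}"
    unfolding matrix_vector_mult_def transpose_def
    by (intro closed_Collect_eq continuous_intros)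
  from closed_compact_projection [OF compact_cball this]
  show ?thesis by (simp only: Bex_def mem_Collect_eq fst_conv snd_conv)
qed

text \<open>
  With a bound on \<open>w\<close>, the condition is closed by compactness; the union over all integer bounds is
  the row space condition.
\<close>

lemma borel_row_space:
  "{B :: real ^ 'k ^ 'n. \<exists>w. transpose B *v w = x} \<in> sets borel"
proof -
  have "{B :: real ^ 'k ^ 'n. \<exists>w. transpose B *v w = x}
      = (\<Union>N::nat. {B. \<exists>w\<in>cball 0 (real N). transpose B *v w = x})"
    using real_arch_simple [of "norm _"] by (fastforce simp del: transpose_matrix_vector)
  also have "\<dots> \<in> sets borel"
    by (intro sets.countable_UN image_subsetI borel_closed closed_row_space_bounded)
  finally show ?thesis .
qed

section \<open>Constants, and the threshold between the two groups of correlations\<close>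

lemma exp_one_bounds: "2.718 \<le> exp (1 :: real)" "exp (1 :: real) \<le> 2.7183"
proof -
  obtain t :: real where "exp 1 = (\<Sum>m<9. 1 ^ m / fact m) + exp t / fact 9 * 1 ^ 9" and t: "\<bar>t\<bar> \<le> 1"
    using Maclaurin_exp_le [of 1 9] by auto
  then have e: "exp (1 :: real) = 109601 / 40320 + exp t / 362880"
    by (simp add: eval_nat_numeral)
  have "exp t \<le> exp 1" using t by simp
  then have "exp t \<le> 272 / 100" using e_less_272 by linarith
  then show "exp (1 :: real) \<le> 2.7183" unfolding e by simp
  have "2.718 \<le> (109601 / 40320 :: real)" by simp
  also have "\<dots> \<le> exp (1 :: real)" unfolding e by simp
  finally show "2.718 \<le> exp (1 :: real)" .
qed

lemma C3_bounds: "17.7 \<le> C3" "4 * C1 + 2 * C2 \<le> 17.71"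
proof -
  have s: "4.3415 \<le> sqrt (6 * pi)" "sqrt (6 * pi) \<le> 4.3417"
    by (rule real_le_rsqrt real_le_lsqrt; use pi_approx in \<open>simp add: power2_eq_square\<close>)+
  have r: "1.4142 \<le> sqrt (2 :: real)" "sqrt (2 :: real) \<le> 1.41422"
    by (rule real_le_rsqrt real_le_lsqrt; simp add: power2_eq_square)+
  have "4 * C1 + 2 * C2 = 16 * exp 1 / sqrt (6 * pi) + 2 * (exp 1 * sqrt 2)"
    by (simp add: C1_def C2_def)
  also have "\<dots> \<le> 16 * 2.7183 / 4.3415 + 2 * (2.7183 * 1.41422)"
    using s r exp_one_bounds by (intro add_mono frac_le mult_mono) auto
  also have "\<dots> \<le> 17.71" by simp
  finally show "4 * C1 + 2 * C2 \<le> 17.71" .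
  have "17.7 \<le> 16 * 2.718 / 4.3417 + 2 * (2.718 * 1.4142 :: real)" by simp
  also have "\<dots> \<le> 16 * exp 1 / sqrt (6 * pi) + 2 * (exp 1 * sqrt 2)"
    using s r exp_one_bounds by (intro add_mono frac_le mult_mono) auto
  also have "\<dots> = C3"
    by (simp add: C1_def C2_def C3_def)
  finally show "17.7 \<le> C3" .
qed

lemma log_mgf_excess_nonneg:
  assumes "0 \<le> l" "l < 1 / 2"
  shows "0 \<le> log_mgf_excess l"
proof -
  have "log_mgf_excess 0 \<le> log_mgf_excess l"
  proof (rule DERIV_nonneg_imp_nondecreasing [OF assms(1)])
    fix x :: real
    assume x: "0 \<le> x" "x \<le> l"
    with assms have "(log_mgf_excess has_real_derivative (1 / (1 - 2 * x) - 1 - 2 * x)) (at x)"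
      unfolding log_mgf_excess_def by (auto intro!: derivative_eq_intros simp: field_simps)
    moreover have "0 \<le> 1 / (1 - 2 * x) - 1 - 2 * x"
      using x assms by (simp add: field_simps)
    ultimately show "\<exists>y. (log_mgf_excess has_real_derivative y) (at x) \<and> 0 \<le> y" by blast
  qed
  then show ?thesis by (simp add: log_mgf_excess_def)
qed

text \<open>
  The first two terms of the power series \<open>\<Sum>k\<ge>3. (2 l)\<^sup>k / (2 k)\<close>; on the given range the remainder is at most
  twice its first term.
\<close>

lemma log_mgf_excess_le:
  assumes "0 \<le> l" "l \<le> 1 / 4"
  shows "log_mgf_excess l \<le> 4 / 3 * l ^ 3 + 2 * l ^ 4 + 32 / 5 * l ^ 5"
proof -
  let ?f = "\<lambda>l. 4 / 3 * l ^ 3 + 2 * l ^ 4 + 32 / 5 * l ^ 5 - log_mgf_excess l"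
  have "?f 0 \<le> ?f l"
  proof (rule DERIV_nonneg_imp_nondecreasing [OF assms(1)])
    fix x :: real
    assume x: "0 \<le> x" "x \<le> l"
    let ?d = "4 * x ^ 2 + 8 * x ^ 3 + 32 * x ^ 4 - (1 / (1 - 2 * x) - 1 - 2 * x)"
    have "(?f has_real_derivative ?d) (at x)"
      unfolding log_mgf_excess_def using x assms
      by (auto intro!: derivative_eq_intros simp: field_simps)
    moreover have "0 \<le> ?d"
    proof -
      have "?d = 16 * x ^ 4 * (1 - 4 * x) / (1 - 2 * x)"
        using x assms by (simp add: field_simps eval_nat_numeral)
      then show ?thesis using x assms by simp
    qed
    ultimately show "\<exists>y. (?f has_real_derivative y) (at x) \<and> 0 \<le> y" by blast
  qed
  then show ?thesis by (simp add: log_mgf_excess_def)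
qed

text \<open>
  The polynomial decreases in \<open>b\<close>.  For \<open>b = 0\<close> its maximum on the interval, about 0.0402 near
  \<open>y = 0.465\<close>, is close to the bound 0.0415; the quartic term is therefore estimated by its tangent
  in \<open>y\<^sup>2\<close> near the maximum and the cubic one by \<open>y\<^sup>2 / 2\<close>, after which a quadratic polynomial remains.
\<close>

lemma separating_threshold_inequality:
  fixes b y :: real
  assumes y: "0 \<le> y" "y \<le> 1 / 2" and b: "0 \<le> b"
  shows "y * (5 / 8 * (1 + b) * (32 / 375 + 32 / 625 * y + 1024 / 15625 * y\<^sup>2)
    + (1 - b - 2 * y) / 2 * (1 / 6 + y / 8 + y\<^sup>2 / 5)) \<le> 49 / 1180"
proof -
  have "y * (5 / 8 * (1 + b) * (32 / 375 + 32 / 625 * y + 1024 / 15625 * y\<^sup>2)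
      + (1 - b - 2 * y) / 2 * (1 / 6 + y / 8 + y\<^sup>2 / 5))
    = (41 / 300 * y - 433 / 6000 * y\<^sup>2 + 399 / 25000 * y ^ 3 - y ^ 4 / 5)
      - b * y * (3 / 100 + 61 / 2000 * y + 369 / 6250 * y\<^sup>2)"
    by (simp add: field_simps eval_nat_numeral)
  moreover have "0 \<le> b * y * (3 / 100 + 61 / 2000 * y + 369 / 6250 * y\<^sup>2)"
    using y b by simp
  moreover have "y ^ 3 \<le> y\<^sup>2 / 2"
    using mult_left_mono [OF y(2), of "y\<^sup>2"] by (simp add: eval_nat_numeral)
  moreover have "0 \<le> (y\<^sup>2 - 11 / 50)\<^sup>2" by simp
  then have "- (y ^ 4) \<le> 121 / 2500 - 11 / 25 * y\<^sup>2"
    by (simp add: power2_eq_square algebra_simps eval_nat_numeral)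
  moreover have "0 \<le> 152 / 1000 * (y - 449 / 1000)\<^sup>2" by simp
  then have "0 \<le> 152 / 1000 * y\<^sup>2 - 17062 / 125000 * y + 30643352 / 1000000000"
    by (simp add: power2_eq_square algebra_simps)
  then have "41 / 300 * y - 152 / 1000 * y\<^sup>2 \<le> 31 / 1000 + y / 3000"
    using y by linarith
  ultimately show ?thesis using y by (simp add: field_simps)
qed

text \<open>
  The two bounds are the exponents, per row, of the probability that a correlation on the support falls below
  \<open>\<theta>\<close> and that a correlation off the support rises above it.  They use \<open>l = \<tau>/2\<close> and \<open>l = 2\<tau>/5\<close>.
  The first value minimizes \<open>l\<^sup>2 - l \<tau>\<close>; the second one is smaller, because off the support the
  excess, which grows like \<open>l\<^sup>3\<close>, has the larger weight.  The constant \<open>40/177\<close> is the reciprocal of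
  \<open>4.425\<close>, a lower bound of \<open>C3 / 4\<close>.
\<close>

lemma ex_separating_threshold:
  fixes b \<tau> :: real
  assumes \<tau>: "0 < \<tau>" and b: "0 \<le> b" "b + 2 * \<tau> \<le> 1"
  obtains \<theta> where
    "\<tau> / 2 * (\<theta> - (b + 2 * \<tau>)) + (\<tau> / 2)\<^sup>2 + (1 - (b + 2 * \<tau>)) / 2 * log_mgf_excess (\<tau> / 2)
      \<le> - (40 / 177 * \<tau>\<^sup>2)"
    "2 * \<tau> / 5 * (b - \<theta>) + (2 * \<tau> / 5)\<^sup>2 + (1 + b) / 2 * log_mgf_excess (2 * \<tau> / 5)
      \<le> - (40 / 177 * \<tau>\<^sup>2)"
proof -
  define E1 where "E1 = log_mgf_excess (\<tau> / 2)"
  define E2 where "E2 = log_mgf_excess (2 * \<tau> / 5)"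
  \<comment> \<open>This choice turns the second bound into an equality.\<close>
  define \<theta> where "\<theta> = b + ((2 * \<tau> / 5)\<^sup>2 + (1 + b) / 2 * E2 + 40 / 177 * \<tau>\<^sup>2) / (2 * \<tau> / 5)"
  have E1: "E1 \<le> \<tau> ^ 3 * (1 / 6 + \<tau> / 8 + \<tau>\<^sup>2 / 5)"
    using log_mgf_excess_le [of "\<tau> / 2"] assms
    by (simp add: E1_def eval_nat_numeral algebra_simps)
  have E2: "E2 \<le> \<tau> ^ 3 * (32 / 375 + 32 / 625 * \<tau> + 1024 / 15625 * \<tau>\<^sup>2)"
    using log_mgf_excess_le [of "2 * \<tau> / 5"] assms
    by (simp add: E2_def eval_nat_numeral algebra_simps)
  have 2: "2 * \<tau> / 5 * (b - \<theta>) + (2 * \<tau> / 5)\<^sup>2 + (1 + b) / 2 * E2 = - (40 / 177 * \<tau>\<^sup>2)"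
    using \<tau> by (simp add: \<theta>_def field_simps)
  have "5 / 8 * (1 + b) * E2 + (1 - (b + 2 * \<tau>)) / 2 * E1
      \<le> 5 / 8 * (1 + b) * (\<tau> ^ 3 * (32 / 375 + 32 / 625 * \<tau> + 1024 / 15625 * \<tau>\<^sup>2))
        + (1 - (b + 2 * \<tau>)) / 2 * (\<tau> ^ 3 * (1 / 6 + \<tau> / 8 + \<tau>\<^sup>2 / 5))"
    using b by (intro add_mono mult_left_mono E1 E2) auto
  also have "\<dots> = \<tau>\<^sup>2 * (\<tau> * (5 / 8 * (1 + b) * (32 / 375 + 32 / 625 * \<tau> + 1024 / 15625 * \<tau>\<^sup>2)
    + (1 - b - 2 * \<tau>) / 2 * (1 / 6 + \<tau> / 8 + \<tau>\<^sup>2 / 5)))"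
    by (simp add: field_simps eval_nat_numeral)
  also have "\<dots> \<le> \<tau>\<^sup>2 * (49 / 1180)"
    using assms by (intro mult_left_mono separating_threshold_inequality) auto
  finally have main: "5 / 8 * (1 + b) * E2 + (1 - (b + 2 * \<tau>)) / 2 * E1 \<le> \<tau>\<^sup>2 * (49 / 1180)" .
  have "\<tau> / 2 * (\<theta> - (b + 2 * \<tau>)) = \<tau>\<^sup>2 / 5 + 5 / 8 * (1 + b) * E2 + 50 / 177 * \<tau>\<^sup>2 - \<tau>\<^sup>2"
    using \<tau> by (simp add: \<theta>_def power2_eq_square field_simps)
  moreover have "(\<tau> / 2)\<^sup>2 = \<tau>\<^sup>2 / 4" by (simp add: power_divide)
  ultimately have 1: "\<tau> / 2 * (\<theta> - (b + 2 * \<tau>)) + (\<tau> / 2)\<^sup>2 + (1 - (b + 2 * \<tau>)) / 2 * E1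
      \<le> - (40 / 177 * \<tau>\<^sup>2)"
    using main by linarith
  show ?thesis
    using that [of \<theta>] 1 2 unfolding E1_def E2_def by simp
qed

section \<open>Correlations of a sparse signal with the atoms\<close>

lemma finite_babel_sums:
  "finite {\<Sum>i\<in>\<Lambda>. \<bar>column i \<Phi> \<bullet> column j \<Phi>\<bar> | \<Lambda> j. card \<Lambda> = k \<and> j \<notin> \<Lambda>}"
  by (rule finite_subset [of _ "(\<lambda>(\<Lambda>, j). \<Sum>i\<in>\<Lambda>. \<bar>column i \<Phi> \<bullet> column j \<Phi>\<bar>) ` UNIV"]) auto

lemma babel_nonneg: "0 \<le> babel \<Phi> k"
  unfolding babel_def using finite_babel_sums by (intro Max_ge) auto

lemma babel_ge:
  assumes "card \<Lambda> = k" "j \<notin> \<Lambda>"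
  shows "(\<Sum>i\<in>\<Lambda>. \<bar>column i \<Phi> \<bullet> column j \<Phi>\<bar>) \<le> babel \<Phi> k"
  unfolding babel_def using assms finite_babel_sums by (intro Max_ge) auto

lemma babel_orthonormal:
  assumes "is_orthonormal_basis \<Phi>"
  shows "babel \<Phi> k = 0"
proof -
  have "(\<Sum>i\<in>\<Lambda>. \<bar>column i \<Phi> \<bullet> column j \<Phi>\<bar>) = 0" if "j \<notin> \<Lambda>" for \<Lambda> j
    using assms that by (intro sum.neutral) (auto simp: is_orthonormal_basis_def)
  then have "insert 0 {\<Sum>i\<in>\<Lambda>. \<bar>column i \<Phi> \<bullet> column j \<Phi>\<bar> | \<Lambda> j. card \<Lambda> = k \<and> j \<notin> \<Lambda>} = {0}"
    by auto
  then show ?thesis by (simp only: babel_def Max_singleton)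
qed

lemma inner_mult_supported:
  fixes \<Phi> :: "real ^ 'k ^ 'd"
  assumes "\<And>l. l \<notin> \<Lambda> \<Longrightarrow> z $ l = 0"
  shows "(\<Phi> *v z) \<bullet> w = (\<Sum>l\<in>\<Lambda>. z $ l * (column l \<Phi> \<bullet> w))"
proof -
  have "\<Phi> *v z = (\<Sum>l\<in>UNIV. z $ l *\<^sub>R column l \<Phi>)"
    by (simp add: matrix_mult_sum scalar_mult_eq_scaleR)
  then have "(\<Phi> *v z) \<bullet> w = (\<Sum>l\<in>UNIV. z $ l * (column l \<Phi> \<bullet> w))"
    by (simp add: inner_sum_left)
  also have "\<dots> = (\<Sum>l\<in>\<Lambda>. z $ l * (column l \<Phi> \<bullet> w))"
    using assms by (intro sum.mono_neutral_right) auto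
  finally show ?thesis .
qed

lemma abs_sum_coeffs_le_babel:
  assumes "card \<Lambda> = k" "j \<notin> \<Lambda>" "\<And>l. \<bar>z $ l\<bar> \<le> m"
  shows "\<bar>\<Sum>l\<in>\<Lambda>. z $ l * (column l \<Phi> \<bullet> column j \<Phi>)\<bar> \<le> m * babel \<Phi> k"
proof -
  have m: "0 \<le> m" using order_trans [OF abs_ge_zero assms(3)] .
  have "\<bar>\<Sum>l\<in>\<Lambda>. z $ l * (column l \<Phi> \<bullet> column j \<Phi>)\<bar>
      \<le> (\<Sum>l\<in>\<Lambda>. m * \<bar>column l \<Phi> \<bullet> column j \<Phi>\<bar>)"
    using assms(3) by (intro order_trans [OF sum_abs] sum_mono) (auto simp: abs_mult intro: mult_right_mono)
  also have "\<dots> = m * (\<Sum>l\<in>\<Lambda>. \<bar>column l \<Phi> \<bullet> column j \<Phi>\<bar>)"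
    by (simp add: sum_distrib_left)
  also have "\<dots> \<le> m * babel \<Phi> k"
    using m by (intro mult_left_mono babel_ge assms)
  finally show ?thesis .
qed

lemma correlation_off_support_le:
  assumes "card \<Lambda> = S" "\<And>l. l \<notin> \<Lambda> \<Longrightarrow> z $ l = 0" "\<And>l. \<bar>z $ l\<bar> \<le> m" "j \<notin> \<Lambda>"
  shows "\<bar>(\<Phi> *v z) \<bullet> column j \<Phi>\<bar> \<le> m * babel \<Phi> S"
  by (subst inner_mult_supported [of \<Lambda> z]) (use assms in \<open>auto intro: abs_sum_coeffs_le_babel\<close>)

lemma correlation_on_support:
  assumes "unit_norm_atoms \<Phi>" "card \<Lambda> = S"
    and "\<And>l. l \<notin> \<Lambda> \<Longrightarrow> z $ l = 0" "\<And>l. \<bar>z $ l\<bar> \<le> m" "i \<in> \<Lambda>"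
  shows "\<bar>(\<Phi> *v z) \<bullet> column i \<Phi> - z $ i\<bar> \<le> m * babel \<Phi> (S - 1)"
proof -
  have "column i \<Phi> \<bullet> column i \<Phi> = 1"
    using assms(1) by (simp add: unit_norm_atoms_def dot_square_norm)
  then have "(\<Phi> *v z) \<bullet> column i \<Phi> - z $ i
      = (\<Sum>l\<in>\<Lambda> - {i}. z $ l * (column l \<Phi> \<bullet> column i \<Phi>))"
    using assms(3,5) by (subst inner_mult_supported [of \<Lambda> z]) (auto simp: sum.remove)
  then show ?thesis
    using assms by (simp add: abs_sum_coeffs_le_babel)
qed

lemma norm_signal_le:
  assumes "unit_norm_atoms \<Phi>" "card \<Lambda> = S"
    and "\<And>l. l \<notin> \<Lambda> \<Longrightarrow> z $ l = 0" "\<And>l. \<bar>z $ l\<bar> \<le> m"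
  shows "(norm (\<Phi> *v z))\<^sup>2 \<le> real S * (1 + babel \<Phi> (S - 1)) * m\<^sup>2"
proof -
  have m: "0 \<le> m" using order_trans [OF abs_ge_zero assms(4)] .
  have "(norm (\<Phi> *v z))\<^sup>2 = (\<Sum>l\<in>\<Lambda>. z $ l * ((\<Phi> *v z) \<bullet> column l \<Phi>))"
    unfolding power2_norm_eq_inner
    by (subst inner_mult_supported [of \<Lambda> z]) (use assms(3) in \<open>auto simp: inner_commute [of "\<Phi> *v z"]\<close>)
  also have "\<dots> \<le> (\<Sum>l\<in>\<Lambda>. m * (m * (1 + babel \<Phi> (S - 1))))"
  proof (rule sum_mono)
    fix l
    assume "l \<in> \<Lambda>"
    then have "\<bar>(\<Phi> *v z) \<bullet> column l \<Phi>\<bar> \<le> m * (1 + babel \<Phi> (S - 1))"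
      using correlation_on_support [OF assms] assms(4) [of l] by (fastforce simp: algebra_simps)
    then have "\<bar>z $ l * ((\<Phi> *v z) \<bullet> column l \<Phi>)\<bar> \<le> m * (m * (1 + babel \<Phi> (S - 1)))"
      unfolding abs_mult using m assms(4) by (intro mult_mono) auto
    then show "z $ l * ((\<Phi> *v z) \<bullet> column l \<Phi>) \<le> m * (m * (1 + babel \<Phi> (S - 1)))" by simp
  qed
  also have "\<dots> = real S * (1 + babel \<Phi> (S - 1)) * m\<^sup>2"
    by (simp add: assms(2) power2_eq_square)
  finally show ?thesis .
qed

text \<open>
  Diagonal dominance of the Gram matrix, read off at the largest coefficient of \<open>z\<close>.
\<close>

lemma atoms_injective_if_babel_less_1:
  assumes "unit_norm_atoms \<Phi>" "card \<Lambda> = S" "babel \<Phi> (S - 1) < 1"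
    and supp: "\<And>l. l \<notin> \<Lambda> \<Longrightarrow> z $ l = 0" and "\<Phi> *v z = 0"
  shows "z = 0"
proof -
  obtain i where i: "\<And>l. \<bar>z $ l\<bar> \<le> \<bar>z $ i\<bar>"
    using Max_in [of "range (\<lambda>l. \<bar>z $ l\<bar>)"] Max_ge [of "range (\<lambda>l. \<bar>z $ l\<bar>)"] by fastforce
  have "z $ i = 0"
  proof (rule ccontr)
    assume nz: "z $ i \<noteq> 0"
    then have "i \<in> \<Lambda>" using supp by blast
    then have "\<bar>z $ i\<bar> \<le> \<bar>z $ i\<bar> * babel \<Phi> (S - 1)"
      using correlation_on_support [OF assms(1,2) supp i] assms(5) by simp
    then show False using nz assms(3) by simp
  qed
  then show ?thesis using i by (simp add: vec_eq_iff)
qed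

section \<open>Success probability of thresholding\<close>

lemma column_matrix_mult: "column j (A ** \<Phi>) = A *v column j \<Phi>"
  by (simp add: vec_eq_iff column_def matrix_matrix_mult_def matrix_vector_mult_def)

lemma half_one_plus_exp_le: "(1 + exp (- 1 / 4)) / 2 \<le> exp (- 20 / 177 :: real)"
proof -
  have "1 + 1 / 4 + (1 / 4)\<^sup>2 / 2 \<le> exp (1 / 4 :: real)"
    by (rule exp_lower_Taylor_quadratic) simp
  then have "exp (- 1 / 4 :: real) \<le> 32 / 41"
    by (simp add: exp_minus power2_eq_square field_simps)
  then have "(1 + exp (- 1 / 4)) / 2 \<le> (1 - 20 / 531 :: real) ^ 3"
    by (simp add: eval_nat_numeral)
  also have "\<dots> \<le> exp (- 20 / 531) ^ 3"
    using exp_ge_add_one_self [of "- 20 / 531 :: real"] by (intro power_mono) auto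
  also have "\<dots> = exp (- 20 / 177 :: real)"
    by (simp add: exp_of_nat_mult [symmetric])
  finally show ?thesis .
qed

text \<open>
  The factor \<open>2 ^ S\<close> costs at most \<open>exp (S L)\<close>, while the \<open>n\<close> rows contribute
  \<open>exp (- 20/177 n) \<le> exp (- 2 S L)\<close>.
\<close>

lemma (in prob_space) prob_annihilating_le:
  fixes A :: "'a \<Rightarrow> real ^ 'd ^ 'n"
  assumes A: "gaussian_matrix M A \<or> bernoulli_matrix M A"
    and V: "subspace V" "dim V \<le> S" and L: "ln 2 \<le> L" and S: "1 \<le> S"
    and n: "177 / 10 * real S * L \<le> real CARD('n)"
  shows "prob {\<omega> \<in> space M. A \<omega> \<in> annihilating V UNIV} \<le> exp (- L)"
proof -
  have "indep_vars (\<lambda>_. borel) (\<lambda>i \<omega>. A \<omega> $ i) UNIV"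
    using A by (intro independent_rows) (auto simp: gaussian_matrix_def bernoulli_matrix_def)
  moreover have "prob {\<omega> \<in> space M. A \<omega> $ k \<bullet> v = 0} \<le> exp (- 1 / 4)" if "v \<noteq> 0" for k v
    using prob_form_eq_0_le [OF row_unit_forms_subgaussian [OF A] that, of k] by simp
  ultimately have "prob {\<omega> \<in> space M. (\<chi> k. A \<omega> $ k) \<in> annihilating V UNIV}
      \<le> 2 ^ dim V * ((1 + exp (- 1 / 4)) / 2) ^ CARD('n)"
    by (intro prob_rows_annihilate_le V(1)) auto
  also have "\<dots> \<le> 2 ^ S * exp (- 20 / 177) ^ CARD('n)"
    using V(2) half_one_plus_exp_le by (intro mult_mono power_increasing power_mono) auto
  also have "\<dots> = exp (real S * ln 2) * exp (real CARD('n) * (- 20 / 177))"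
    by (simp only: exp_of_nat_mult exp_ln zero_less_numeral)
  also have "\<dots> = exp (real S * ln 2 - 20 / 177 * real CARD('n))"
    unfolding mult_exp_exp by (simp add: algebra_simps)
  also have "\<dots> \<le> exp (- L)"
  proof -
    have "real S * ln 2 \<le> real S * L" using L by (intro mult_left_mono) auto
    moreover have "1 * L \<le> real S * L"
      using S L order_trans [OF ln_ge_zero [of 2] L] by (intro mult_right_mono) auto
    ultimately show ?thesis using n by simp
  qed
  finally show ?thesis by simp
qed

lemma measurable_thresholding_recovers:
  fixes A :: "'w \<Rightarrow> real ^ 'd ^ 'n" and \<Phi> :: "real ^ 'k ^ 'd"
  assumes A: "A \<in> borel_measurable M"
    and \<Lambda>: "\<Lambda> = {i. x $ i \<noteq> 0}" "card \<Lambda> = S" and y: "y = \<Phi> *v x"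
  shows "{\<omega> \<in> space M. thresholding_recovers \<Phi> S x y (A \<omega>)} \<in> sets M"
proof -
  have corr: "(\<lambda>B :: real ^ 'd ^ 'n. \<bar>(B *v y) \<bullet> column j (B ** \<Phi>)\<bar>) \<in> borel_measurable borel" for j
    unfolding inner_vec_def matrix_vector_mult_def matrix_matrix_mult_def column_def
    by (intro borel_measurable_continuous_onI continuous_intros)
  have [measurable]: "(\<lambda>\<omega>. \<bar>(A \<omega> *v y) \<bullet> column j (A \<omega> ** \<Phi>)\<bar>) \<in> borel_measurable M" for j
    using measurable_compose [OF A corr] .
  have [measurable]: "Measurable.pred M (\<lambda>\<omega>. largest_correlations (A \<omega> ** \<Phi>) S (A \<omega> *v y) \<Lambda>')" for \<Lambda>'
    unfolding largest_correlations_def Ball_def by measurable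
  have sub: "(\<lambda>B :: real ^ 'd ^ 'n. restrict_columns (B ** \<Phi>) \<Lambda>) \<in> borel_measurable borel"
  proof (rule borel_measurable_vecI, rule borel_measurable_vecI)
    fix i j
    show "(\<lambda>B :: real ^ 'd ^ 'n. restrict_columns (B ** \<Phi>) \<Lambda> $ i $ j) \<in> borel_measurable borel"
      unfolding restrict_columns_def matrix_matrix_mult_def
      by (cases "j \<in> \<Lambda>") (auto intro!: borel_measurable_continuous_onI continuous_intros)
  qed
  have [measurable]: "Measurable.pred M (\<lambda>\<omega>. \<exists>w. transpose (restrict_columns (A \<omega> ** \<Phi>) \<Lambda>) *v w = x)"
    using measurable_sets [OF measurable_compose [OF A sub] borel_row_space [of x]]
    by (simp only: pred_def vimage_def Int_def mem_Collect_eq conj_commute)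
  show ?thesis
    unfolding thresholding_recovers_iff [OF \<Lambda> y] by measurable
qed

text \<open>
  The union bound over the events \<open>Low i\<close> (correlation at most \<open>\<theta>\<close> on the support), \<open>Up s j\<close>
  (correlation of sign \<open>s\<close> and modulus at least \<open>\<theta>\<close> off the support) and \<open>Sing\<close> (loss of injectivity on
  the span of the atoms in \<open>\<Lambda>\<close>), each of probability at most \<open>exp (- L)\<close>.
\<close>

lemma (in prob_space) thresholding_recovery_probability:
  fixes \<Phi> :: "real ^ 'k ^ 'd" and A :: "'a \<Rightarrow> real ^ 'd ^ 'n"
  defines "\<mu> \<equiv> babel \<Phi>"
  assumes \<Phi>: "unit_norm_atoms \<Phi>"
    and \<Lambda>: "\<Lambda> = {i. x $ i \<noteq> 0}" "card \<Lambda> = S" "S \<ge> 1" and y: "y = \<Phi> *v x"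
    and A: "gaussian_matrix M A \<or> bernoulli_matrix M A" and t: "t > 0"
    and \<delta>: "\<delta> = min_abs_coeff x \<Lambda> / infnorm x - \<mu> S - \<mu> (S - 1)" "0 < \<delta>"
    and n: "177 / 10 * real S * (1 + \<mu> (S - 1)) * (ln (2 * real CARD('k)) + t) / \<delta>\<^sup>2 \<le> real CARD('n)"
  shows "1 - exp (- t) \<le> prob {\<omega> \<in> space M. thresholding_recovers \<Phi> S x y (A \<omega>)}"
proof -
  define L where "L = ln (2 * real CARD('k)) + t"
  define m where "m = infnorm x"
  define p where "p = min_abs_coeff x \<Lambda>"
  have card1: "1 \<le> real CARD('k)"
    using zero_less_card_finite [where 'a = 'k] by linarith
  have L: "ln 2 \<le> L" "0 < L"
    using card1 t by (auto simp: L_def ln_mult intro: add_nonneg_pos add_pos_pos)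
  have \<mu>: "0 \<le> \<mu> k" for k unfolding \<mu>_def by (rule babel_nonneg)
  have ne: "\<Lambda> \<noteq> {}" using \<Lambda>(2,3) by auto
  have supp: "x $ l = 0" if "l \<notin> \<Lambda>" for l using that \<Lambda>(1) by simp
  have xm: "\<bar>x $ l\<bar> \<le> m" for l unfolding m_def by (rule component_le_infnorm_cart)
  have xp: "p \<le> \<bar>x $ l\<bar>" if "l \<in> \<Lambda>" for l
    unfolding p_def min_abs_coeff_def using that by (intro Min_le) auto
  obtain i0 where i0: "i0 \<in> \<Lambda>" using ne by blast
  have m: "0 < m" using xm [of i0] i0 \<Lambda>(1) by auto
  have pm: "p \<le> m" using xp [OF i0] xm [of i0] by simp
  have m\<delta>: "m * \<delta> = p - m * \<mu> S - m * \<mu> (S - 1)"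
    using m by (simp add: \<delta>(1) m_def p_def algebra_simps)
  have \<delta>1: "\<delta> \<le> 1"
    using \<delta>(1) \<mu> [of S] \<mu> [of "S - 1"] pm m divide_le_eq_1_pos [of m p]
    unfolding m_def p_def by linarith
  have \<mu>1: "\<mu> (S - 1) < 1"
    using \<delta> \<mu> [of S] pm m divide_le_eq_1_pos [of m p] unfolding m_def p_def by linarith
  have on: "p - m * \<mu> (S - 1) \<le> \<bar>y \<bullet> column i \<Phi>\<bar>" if "i \<in> \<Lambda>" for i
    using correlation_on_support [OF \<Phi> \<Lambda>(2) supp xm that] xp [OF that] by (simp add: y \<mu>_def)
  have off: "\<bar>y \<bullet> column j \<Phi>\<bar> \<le> m * \<mu> S" if "j \<notin> \<Lambda>" for j
    using correlation_off_support_le [OF \<Lambda>(2) supp xm that] by (simp add: y \<mu>_def)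
  define N where "N = norm y"
  have gap: "0 < p - m * \<mu> (S - 1)"
    using m\<delta> m \<delta>(2) \<mu> [of S] by (smt (verit) mult_nonneg_nonneg mult_pos_pos)
  have N: "0 < N"
    using on [OF i0] gap by (auto simp: N_def)
  have N2: "N\<^sup>2 \<le> real S * (1 + \<mu> (S - 1)) * m\<^sup>2"
    using norm_signal_le [OF \<Phi> \<Lambda>(2) supp xm] by (simp add: N_def y \<mu>_def)
  define u where "u = (1 / N) *\<^sub>R y"
  have u: "norm u = 1" using N by (simp add: u_def N_def)
  have atom: "norm (column j \<Phi>) = 1" for j using \<Phi> by (simp add: unit_norm_atoms_def)
  define \<tau> where "\<tau> = m * \<delta> / (2 * N)"
  define b where "b = m * \<mu> S / N"
  have \<tau>: "0 < \<tau>" using m \<delta>(2) N by (simp add: \<tau>_def)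
  have b: "0 \<le> b" using m \<mu> N by (simp add: b_def)
  have a: "b + 2 * \<tau> = (p - m * \<mu> (S - 1)) / N"
    using N m\<delta> by (simp add: b_def \<tau>_def field_simps)
  have u_on: "b + 2 * \<tau> \<le> \<bar>u \<bullet> column i \<Phi>\<bar>" if "i \<in> \<Lambda>" for i
    unfolding a using on [OF that] N by (simp add: u_def abs_mult divide_right_mono)
  have u_off: "\<bar>u \<bullet> column j \<Phi>\<bar> \<le> b" if "j \<notin> \<Lambda>" for j
    unfolding b_def using off [OF that] N by (simp add: u_def abs_mult divide_right_mono)
  have a1: "b + 2 * \<tau> \<le> 1"
    using u_on [OF i0] Cauchy_Schwarz_ineq2 [of u "column i0 \<Phi>"] u atom by simp
  have n\<delta>: "177 / 10 * real S * (1 + \<mu> (S - 1)) * L \<le> real CARD('n) * \<delta>\<^sup>2"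
    using n \<delta>(2) by (simp add: L_def pos_divide_le_eq)
  \<comment> \<open>The number of samples, expressed through the normalized half gap \<open>\<tau>\<close>.\<close>
  have nL: "L \<le> real CARD('n) * (40 / 177 * \<tau>\<^sup>2)"
  proof -
    have "177 / 10 * L * N\<^sup>2 \<le> 177 / 10 * L * (real S * (1 + \<mu> (S - 1)) * m\<^sup>2)"
      using N2 L by (intro mult_left_mono) auto
    also have "\<dots> \<le> real CARD('n) * \<delta>\<^sup>2 * m\<^sup>2"
      using mult_right_mono [OF n\<delta>, of "m\<^sup>2"] by (simp add: mult_ac)
    finally have "177 / 10 * L \<le> real CARD('n) * \<delta>\<^sup>2 * m\<^sup>2 / N\<^sup>2"
      using N by (simp add: field_simps)
    also have "\<dots> = real CARD('n) * (4 * \<tau>\<^sup>2)"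
      by (simp add: \<tau>_def power_divide power_mult_distrib)
    finally show ?thesis by simp
  qed
  obtain \<theta> where \<theta>1: "\<tau> / 2 * (\<theta> - (b + 2 * \<tau>)) + (\<tau> / 2)\<^sup>2
        + (1 - (b + 2 * \<tau>)) / 2 * log_mgf_excess (\<tau> / 2) \<le> - (40 / 177 * \<tau>\<^sup>2)"
    and \<theta>2: "2 * \<tau> / 5 * (b - \<theta>) + (2 * \<tau> / 5)\<^sup>2
        + (1 + b) / 2 * log_mgf_excess (2 * \<tau> / 5) \<le> - (40 / 177 * \<tau>\<^sup>2)"
    using ex_separating_threshold [OF \<tau> b a1] by blast
  have tail: "prob {\<omega> \<in> space M. c \<le> (A \<omega> *v u) \<bullet> (A \<omega> *v v)} \<le> exp (- L)"
    if l: "0 \<le> l" "l < 1 / 2" and v: "norm v = 1" "u \<bullet> v \<le> \<rho>"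
      and h: "l * (\<rho> - c) + l\<^sup>2 + (1 + \<rho>) / 2 * log_mgf_excess l \<le> - (40 / 177 * \<tau>\<^sup>2)"
    for l c \<rho> v
  proof -
    have "l * (u \<bullet> v - c) + l\<^sup>2 + (1 + u \<bullet> v) / 2 * log_mgf_excess l
        \<le> l * (\<rho> - c) + l\<^sup>2 + (1 + \<rho>) / 2 * log_mgf_excess l"
      using l v log_mgf_excess_nonneg [OF l] by (intro add_mono mult_left_mono mult_right_mono) auto
    also note h
    finally have "real CARD('n) * (l * (u \<bullet> v - c) + l\<^sup>2 + (1 + u \<bullet> v) / 2 * log_mgf_excess l)
        \<le> real CARD('n) * - (40 / 177 * \<tau>\<^sup>2)"
      by (intro mult_left_mono) auto
    also have "\<dots> \<le> - L" using nL by simp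
    finally show ?thesis
      by (intro order_trans [OF chernoff_compressed_inner [OF A u v(1) l]]) simp
  qed
  define \<sigma> where "\<sigma> = (\<lambda>i. if 0 \<le> u \<bullet> column i \<Phi> then 1 else - 1 :: real)"
  define Low where "Low = (\<lambda>i. {\<omega> \<in> space M. - \<theta> \<le> (A \<omega> *v u) \<bullet> (A \<omega> *v (- \<sigma> i *\<^sub>R column i \<Phi>))})"
  define Up where "Up = (\<lambda>s j. {\<omega> \<in> space M. \<theta> \<le> (A \<omega> *v u) \<bullet> (A \<omega> *v (s *\<^sub>R column j \<Phi>))})"
  define V where "V = (*v) \<Phi> ` {z. \<forall>l. l \<notin> \<Lambda> \<longrightarrow> z $ l = 0}"
  define Sing where "Sing = {\<omega> \<in> space M. A \<omega> \<in> annihilating V UNIV}"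
  have Low: "prob (Low i) \<le> exp (- L)" if "i \<in> \<Lambda>" for i
    unfolding Low_def
  proof (rule tail [of "\<tau> / 2" _ "- (b + 2 * \<tau>)"])
    show "norm (- \<sigma> i *\<^sub>R column i \<Phi>) = 1" by (simp add: \<sigma>_def atom)
    show "u \<bullet> (- \<sigma> i *\<^sub>R column i \<Phi>) \<le> - (b + 2 * \<tau>)"
      using u_on [OF that] by (auto simp: \<sigma>_def abs_if split: if_splits)
    show "\<tau> / 2 * (- (b + 2 * \<tau>) - - \<theta>) + (\<tau> / 2)\<^sup>2 + (1 + - (b + 2 * \<tau>)) / 2 * log_mgf_excess (\<tau> / 2)
        \<le> - (40 / 177 * \<tau>\<^sup>2)"
      using \<theta>1 by (simp add: algebra_simps)
  qed (use \<tau> a1 b in auto)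
  have Up: "prob (Up s j) \<le> exp (- L)" if "j \<notin> \<Lambda>" "s = 1 \<or> s = - 1" for s j
    unfolding Up_def
  proof (rule tail [of "2 * \<tau> / 5" _ b])
    show "norm (s *\<^sub>R column j \<Phi>) = 1" "u \<bullet> (s *\<^sub>R column j \<Phi>) \<le> b"
      using that u_off [OF that(1)] atom by auto
  qed (use \<tau> a1 b \<theta>2 in auto)
  have Sing: "prob Sing \<le> exp (- L)"
    unfolding Sing_def
  proof (rule prob_annihilating_le [OF A, where S = S])
    have lin: "linear ((*v) \<Phi>)" by simp
    show "subspace V"
      unfolding V_def by (intro linear_subspace_image [OF lin]) (auto simp: subspace_def)
    have "V \<subseteq> span ((\<lambda>l. column l \<Phi>) ` \<Lambda>)"
    proof
      fix v
      assume "v \<in> V"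
      then obtain z where z: "v = \<Phi> *v z" "\<And>l. l \<notin> \<Lambda> \<Longrightarrow> z $ l = 0" by (auto simp: V_def)
      have "v = (\<Sum>l\<in>UNIV. z $ l *\<^sub>R column l \<Phi>)"
        by (simp add: z(1) matrix_mult_sum scalar_mult_eq_scaleR)
      also have "\<dots> = (\<Sum>l\<in>\<Lambda>. z $ l *\<^sub>R column l \<Phi>)"
        using z(2) by (intro sum.mono_neutral_right) auto
      also have "\<dots> \<in> span ((\<lambda>l. column l \<Phi>) ` \<Lambda>)"
        by (intro span_sum span_scale span_base) auto
      finally show "v \<in> span ((\<lambda>l. column l \<Phi>) ` \<Lambda>)" .
    qed
    then have "dim V \<le> card ((\<lambda>l. column l \<Phi>) ` \<Lambda>)" by (rule dim_le_card) simp
    also have "\<dots> \<le> S" using card_image_le [of \<Lambda>] \<Lambda>(2) by simp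
    finally show "dim V \<le> S" .
    have "177 / 10 * real S * L * \<delta>\<^sup>2 \<le> 177 / 10 * real S * L * (1 + \<mu> (S - 1))"
      using L \<mu> [of "S - 1"] \<delta> \<delta>1 power_le_one [of \<delta> 2] by (intro mult_left_mono) auto
    also have "\<dots> \<le> real CARD('n) * \<delta>\<^sup>2"
      using n\<delta> by (simp add: mult_ac)
    finally show "177 / 10 * real S * L \<le> real CARD('n)"
      using \<delta>(2) by simp
  qed (use L \<Lambda> in auto)
  have A_meas [measurable]: "A \<in> borel_measurable M"
  proof (rule borel_measurable_vecI)
    fix k
    have "indep_vars (\<lambda>_. borel) (\<lambda>i \<omega>. A \<omega> $ i) UNIV"
      using A by (intro independent_rows) (auto simp: gaussian_matrix_def bernoulli_matrix_def)
    then show "(\<lambda>\<omega>. A \<omega> $ k) \<in> borel_measurable M" by (simp add: indep_vars_def)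
  qed
  have form: "(\<lambda>\<omega>. (A \<omega> *v v) \<bullet> (A \<omega> *v w)) \<in> borel_measurable M" for v w
    unfolding inner_vec_def [of "A _ *v v"] matrix_vector_mul_component by measurable
  have Low_ev: "Low i \<in> events" and Up_ev: "Up s j \<in> events" for i s j
    unfolding Low_def Up_def using form by measurable
  have "subspace V"
    unfolding V_def by (intro linear_subspace_image) (auto simp: subspace_def)
  then have Sing_ev: "Sing \<in> events"
    unfolding Sing_def using measurable_sets [OF A_meas borel_closed [OF closed_annihilating]]
    by (simp add: vimage_def Int_def conj_commute)
  define Good where "Good = {\<omega> \<in> space M. thresholding_recovers \<Phi> S x y (A \<omega>)}"
  have Good_ev: "Good \<in> events"
    unfolding Good_def by (rule measurable_thresholding_recovers [OF A_meas \<Lambda>(1,2) y])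
  define Bad where "Bad = (\<Union>i\<in>\<Lambda>. Low i) \<union> ((\<Union>j\<in>- \<Lambda>. Up 1 j) \<union> (\<Union>j\<in>- \<Lambda>. Up (- 1) j)) \<union> Sing"
  have recovers: "\<omega> \<in> Good" if \<omega>: "\<omega> \<in> space M" "\<omega> \<notin> Bad" for \<omega>
  proof -
    define c where "c = (\<lambda>j. (A \<omega> *v u) \<bullet> (A \<omega> *v column j \<Phi>))"
    have c: "(A \<omega> *v y) \<bullet> column j (A \<omega> ** \<Phi>) = N * c j" for j
      using N by (simp add: c_def u_def column_matrix_mult matrix_vector_mult_scaleR)
    have scaled: "(A \<omega> *v u) \<bullet> (A \<omega> *v (s *\<^sub>R column j \<Phi>)) = s * c j" for s j
      unfolding matrix_vector_mult_scaleR c_def by simp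
    have above: "\<theta> < \<bar>c i\<bar>" if "i \<in> \<Lambda>" for i
    proof -
      have "\<omega> \<notin> Low i" using \<omega> that by (auto simp: Bad_def)
      then have "\<theta> < \<sigma> i * c i"
        using \<omega>(1) unfolding Low_def mem_Collect_eq scaled by simp
      then show ?thesis by (auto simp: \<sigma>_def split: if_splits)
    qed
    have below: "\<bar>c j\<bar> < \<theta>" if "j \<notin> \<Lambda>" for j
    proof -
      have "\<omega> \<notin> Up 1 j" "\<omega> \<notin> Up (- 1) j" using \<omega> that by (auto simp: Bad_def)
      then show ?thesis
        using \<omega>(1) unfolding Up_def mem_Collect_eq scaled by auto
    qed
    have "thresholding_recovers \<Phi> S x y (A \<omega>)"
    proof (rule thresholding_recoversI [OF \<Lambda>(1,2) y])
      fix i j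
      assume "i \<in> \<Lambda>" "j \<notin> \<Lambda>"
      then show "\<bar>(A \<omega> *v y) \<bullet> column j (A \<omega> ** \<Phi>)\<bar> < \<bar>(A \<omega> *v y) \<bullet> column i (A \<omega> ** \<Phi>)\<bar>"
        unfolding c using above [of i] below [of j] N by (simp add: abs_mult)
    next
      fix z
      assume z: "\<And>j. j \<notin> \<Lambda> \<Longrightarrow> z $ j = 0" "(A \<omega> ** \<Phi>) *v z = 0"
      have "\<Phi> *v z = 0"
      proof (rule ccontr)
        assume "\<Phi> *v z \<noteq> 0"
        moreover have "\<Phi> *v z \<in> V" using z(1) by (auto simp: V_def)
        moreover have "A \<omega> *v (\<Phi> *v z) = 0" using z(2) by (simp add: matrix_vector_mul_assoc)
        then have "A \<omega> $ k \<bullet> (\<Phi> *v z) = 0" for k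
          by (metis matrix_vector_mul_component zero_index)
        ultimately have "A \<omega> \<in> annihilating V UNIV" by (auto simp: annihilating_def)
        then show False using \<omega> by (simp add: Bad_def Sing_def)
      qed
      then show "z = 0"
        using atoms_injective_if_babel_less_1 [OF \<Phi> \<Lambda>(2) _ z(1)] \<mu>1 by (simp add: \<mu>_def)
    qed
    then show ?thesis using \<omega> by (simp add: Good_def)
  qed
  have union: "prob (\<Union>i\<in>I. F i) \<le> real (card I) * exp (- L)"
    if "\<And>i. i \<in> I \<Longrightarrow> F i \<in> events" "\<And>i. i \<in> I \<Longrightarrow> prob (F i) \<le> exp (- L)" for I :: "'k set" and F
  proof -
    have "prob (\<Union>i\<in>I. F i) \<le> (\<Sum>i\<in>I. prob (F i))"
      using that(1) by (intro finite_measure_subadditive_finite) auto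
    also have "\<dots> \<le> (\<Sum>i\<in>I. exp (- L))" by (intro sum_mono that)
    finally show ?thesis by simp
  qed
  have cardC: "real (card (- \<Lambda>)) = real CARD('k) - real S"
    using \<Lambda>(2) card_mono [of UNIV \<Lambda>] by (simp add: Compl_eq_Diff_UNIV card_Diff_subset of_nat_diff)
  have Bad_ev: "Bad \<in> events"
    unfolding Bad_def using Low_ev Up_ev Sing_ev by (intro sets.Un sets.finite_UN) auto
  have "prob Bad \<le> prob (\<Union>i\<in>\<Lambda>. Low i) + (prob (\<Union>j\<in>- \<Lambda>. Up 1 j) + prob (\<Union>j\<in>- \<Lambda>. Up (- 1) j)) + prob Sing"
    unfolding Bad_def using Low_ev Up_ev Sing_ev
    by (intro order_trans [OF measure_Un_le] add_mono order_refl sets.Un sets.finite_UN) auto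
  also have "\<dots> \<le> real S * exp (- L) + ((real CARD('k) - real S) * exp (- L) + (real CARD('k) - real S) * exp (- L)) + exp (- L)"
    using union [of \<Lambda> Low] union [of "- \<Lambda>" "Up 1"] union [of "- \<Lambda>" "Up (- 1)"] Low Up Sing Low_ev Up_ev
    by (intro add_mono) (auto simp: cardC \<Lambda>(2))
  also have "\<dots> = (2 * real CARD('k) - (real S - 1)) * exp (- L)"
    by (simp add: algebra_simps)
  also have "\<dots> \<le> 2 * real CARD('k) * exp (- L)"
    using \<Lambda>(3) by (intro mult_right_mono) auto
  also have "\<dots> = exp (- t)"
    using card1 by (simp add: L_def exp_diff exp_minus exp_add field_simps)
  finally have "prob Bad \<le> exp (- t)" .
  moreover have "1 - prob Bad \<le> prob Good"
    unfolding prob_compl [OF Bad_ev, symmetric] using recovers Good_ev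
    by (intro finite_measure_mono) auto
  ultimately show ?thesis by (simp add: Good_def)
qed

theorem corollary3p3:
  fixes \<Phi> :: "real ^ 'k ^ 'd"
    and x :: "real ^ 'k" and y :: "real ^ 'd" and \<Lambda> :: "'k set" and S :: nat
    and M :: "'w measure" and A :: "'w \<Rightarrow> real ^ 'd ^ 'n"
    and t :: real
  assumes "unit_norm_atoms \<Phi>"
    and "\<Lambda> = {i. x $ i \<noteq> 0}" and "card \<Lambda> = S" and "S \<ge> 1"
    and "y = restrict_columns \<Phi> \<Lambda> *v x"
    and "prob_space M"
    and "gaussian_matrix M A \<or> bernoulli_matrix M A"
    and "t > 0"
  shows
    "C3 \<le> 4 * C1 + 2 * C2 \<and> 4 * C1 + 2 * C2 \<le> 17.71 \<and>
     (min_abs_coeff x \<Lambda> / infnorm x > babel \<Phi> S + babel \<Phi> (S - 1) \<longrightarrow>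
      real CARD('n) \<ge> C3 * real S * (1 + babel \<Phi> (S - 1)) * (ln (2 * real CARD('k)) + t)
        / (min_abs_coeff x \<Lambda> / infnorm x - babel \<Phi> S - babel \<Phi> (S - 1))\<^sup>2 \<longrightarrow>
      measure M {\<omega> \<in> space M. thresholding_recovers \<Phi> S x y (A \<omega>)} \<ge> 1 - exp (- t)) \<and>
     (is_orthonormal_basis \<Phi> \<longrightarrow>
      min_abs_coeff x \<Lambda> / infnorm x > babel \<Phi> S + babel \<Phi> (S - 1) \<and>
      C3 * real S * (1 + babel \<Phi> (S - 1)) * (ln (2 * real CARD('k)) + t)
        / (min_abs_coeff x \<Lambda> / infnorm x - babel \<Phi> S - babel \<Phi> (S - 1))\<^sup>2
        = C3 * real S * (infnorm x / min_abs_coeff x \<Lambda>)\<^sup>2 * (ln (2 * real CARD('k)) + t) \<and>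
      (real CARD('n) > C3 * real S * (infnorm x / min_abs_coeff x \<Lambda>)\<^sup>2
          * (ln (2 * real CARD('k)) + t) \<longrightarrow>
       measure M {\<omega> \<in> space M. thresholding_recovers \<Phi> S x y (A \<omega>)} \<ge> 1 - exp (- t)))"
proof -
  interpret prob_space M by fact
  let ?r = "min_abs_coeff x \<Lambda> / infnorm x" and ?\<mu> = "babel \<Phi>"
  have y: "y = \<Phi> *v x"
    unfolding assms(5) by (rule restrict_columns_mult_supported) (simp add: assms(2))
  \<comment> \<open>The recovery bound holds with the constant 17.7, which is slightly smaller than \<open>C3\<close>.\<close>
  have "0 \<le> ln (2 * real CARD('k)) + t"
    using assms(8) zero_less_card_finite [where 'a = 'k] by (intro add_nonneg_nonneg ln_ge_zero) linarith+
  then have "177 / 10 * (real S * (1 + ?\<mu> (S - 1)) * (ln (2 * real CARD('k)) + t) / D\<^sup>2)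
      \<le> C3 * (real S * (1 + ?\<mu> (S - 1)) * (ln (2 * real CARD('k)) + t) / D\<^sup>2)" for D
    using C3_bounds(1) babel_nonneg [of \<Phi> "S - 1"] by (intro mult_right_mono) auto
  then have general: "1 - exp (- t) \<le> prob {\<omega> \<in> space M. thresholding_recovers \<Phi> S x y (A \<omega>)}"
    if "?\<mu> S + ?\<mu> (S - 1) < ?r"
      "C3 * real S * (1 + ?\<mu> (S - 1)) * (ln (2 * real CARD('k)) + t) / (?r - ?\<mu> S - ?\<mu> (S - 1))\<^sup>2
        \<le> real CARD('n)"
    using that
    by (intro thresholding_recovery_probability [OF assms(1-4) y assms(7,8) refl])
      (auto simp: mult.assoc intro: order_trans)
  have "\<Lambda> \<noteq> {}" using assms(3,4) by auto
  then have "0 < min_abs_coeff x \<Lambda>"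
    unfolding min_abs_coeff_def by (subst Min_gr_iff) (auto simp: assms(2))
  moreover have "infnorm x \<noteq> 0"
    using \<open>\<Lambda> \<noteq> {}\<close> by (auto simp: infnorm_eq_0 assms(2))
  then have "0 < infnorm x" using infnorm_pos_le [of x] by simp
  ultimately have r: "0 < ?r" and inv: "X / ?r\<^sup>2 = X * (infnorm x / min_abs_coeff x \<Lambda>)\<^sup>2" for X
    by (simp_all add: power_divide)
  have special: "?\<mu> S + ?\<mu> (S - 1) < ?r"
    "C3 * real S * (1 + ?\<mu> (S - 1)) * (ln (2 * real CARD('k)) + t) / (?r - ?\<mu> S - ?\<mu> (S - 1))\<^sup>2
      = C3 * real S * (infnorm x / min_abs_coeff x \<Lambda>)\<^sup>2 * (ln (2 * real CARD('k)) + t)"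
    if "is_orthonormal_basis \<Phi>"
    using r by (simp_all only: babel_orthonormal [OF that] add_0 diff_0_right inv) (simp_all add: mult_ac)
  show ?thesis
    using general special C3_bounds(2) by (auto simp: C3_def)
qed

end
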